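(* Fix a real number $a\ge0$. For $n\ge1$ let $W_{n,a}=\sum_{m=1}^n m^a$ and define $V_{n,a}:\{0,\dots,n\}\to\mathbb R$ by $$V_{n,a}(0)=\frac1{W_{n,a}}\sum_{k=1}^n k^{a-1},\qquad V_{n,a}(r)=\frac1{W_{n,a}}\sum_{k=r+1}^n k^a\,\frac rk\sum_{j=r}^{k-1}\frac1j\quad(1\le r\le n).$$ Let $\Delta_{n,a}(r)=V_{n,a}(r)-V_{n,a}(r-1)$ and $D_{n,a}(r)=W_{n,a}\,n^{1-a}\,\Delta_{n,a}(r)$ for $1\le r\le n$. For $x\in(0,1)$ let $$I_a(x)=\int_x^1 y^{a-1}\left(\log\frac yx-1\right)dy,$$ $$J_a(x)=\frac12\left(\log\frac1x-1-x^{a-1}\right)+\frac1{2x}\int_x^1y^{a-1}\,dy-\frac12\int_x^1y^{a-2}\,dy .$$ Then: 1. $I_a$ has a unique zero $\ell_a$ in $(0,1)$, and $I_a'(\ell_a)<0$; 2. for every $n$ the sequence $\{V_{n,a}(r)\}_{r=0}^n$ is unimodal, and its largest maximizer $r_{n,a}^{\mathrm{opt}}$ satisfies $r_{n,a}^{\mathrm{opt}}/n\to\ell_a$ as $n\to\infty$; 3. with $c_a:=-J_a(\ell_a)/I_a'(\ell_a)$, one has $0<c_a<\frac12$, and uniformly for bounded $u$ such that $\ell_a n+u$ is an integer in $\{1,\dots,n\}$, $$D_{n,a}(\ell_a n+u)=I_a'(\ell_a)(u-c_a)+O(n^{-1})\qquad(n\to\infty).$$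
   Context: Empty sums are zero. A finite sequence $\{V(r)\}_{r=0}^n$ is unimodal if there exist $0\le \alpha\le \beta\le n$ with $V(0)\le\cdots\le V(\alpha)=\cdots=V(\beta)\ge\cdots\ge V(n)$. "Uniformly for bounded $u$" means: for each $M>0$ there are $K,n_0$ (depending on $a$, $M$) such that the error is at most $K/n$ for all $n\ge n_0$ and all $u$ with $|u|\le M$ and $\ell_an+u\in\{1,\dots,n\}$ an integer. Model: the secretary problem where the number $N$ of applicants is random with $\mathbb P(N=k)=k^a/W_{n,a}$, $1\le k\le n$; $V_{n,a}(r)$ is the probability of selecting the best applicant when rejecting the first $r$ applicants and then accepting the first subsequent record. *)

theory Defs
  imports "HOL-Analysis.Analysis"
begin

text \<open>
  Secretary problem with a random number of applicants, where k applicants have weight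
  proportional to \<open>k powr a\<close>. The bases of all \<open>powr\<close> terms below are positive wherever the
  definitions are used, so the convention \<open>0 powr b = 0\<close> plays no role.
\<close>

definition W :: "real \<Rightarrow> nat \<Rightarrow> real" where
  "W a n = (\<Sum>m=1..n. real m powr a)"

definition V :: "real \<Rightarrow> nat \<Rightarrow> nat \<Rightarrow> real" where
  "V a n r =
    (if r = 0 then 1 / W a n * (\<Sum>k=1..n. real k powr (a - 1))
     else 1 / W a n *
       (\<Sum>k=r+1..n. real k powr a * (real r / real k) * (\<Sum>j=r..k-1. 1 / real j)))"

definition Delta :: "real \<Rightarrow> nat \<Rightarrow> nat \<Rightarrow> real" where
  "Delta a n r = V a n r - V a n (r - 1)"

definition D :: "real \<Rightarrow> nat \<Rightarrow> nat \<Rightarrow> real" where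
  "D a n r = W a n * real n powr (1 - a) * Delta a n r"

definition I :: "real \<Rightarrow> real \<Rightarrow> real" where
  "I a x = integral {x..1} (\<lambda>y. y powr (a - 1) * (ln (y / x) - 1))"

definition J :: "real \<Rightarrow> real \<Rightarrow> real" where
  "J a x = 1 / 2 * (ln (1 / x) - 1 - x powr (a - 1))
     + 1 / (2 * x) * integral {x..1} (\<lambda>y. y powr (a - 1))
     - 1 / 2 * integral {x..1} (\<lambda>y. y powr (a - 2))"

definition unimodal :: "nat \<Rightarrow> (nat \<Rightarrow> real) \<Rightarrow> bool" where
  "unimodal n v \<longleftrightarrow>
    (\<exists>\<alpha> \<beta>. \<alpha> \<le> \<beta> \<and> \<beta> \<le> n \<and>
       (\<forall>r\<in>{0..<\<alpha>}. v r \<le> v (Suc r)) \<and>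
       (\<forall>r\<in>{\<alpha>..<\<beta>}. v r = v (Suc r)) \<and>
       (\<forall>r\<in>{\<beta>..<n}. v r \<ge> v (Suc r)))"

definition r_opt :: "real \<Rightarrow> nat \<Rightarrow> nat" where
  "r_opt a n = Max {r \<in> {0..n}. \<forall>s\<in>{0..n}. V a n s \<le> V a n r}"

definition ell :: "real \<Rightarrow> real" where
  "ell a = (THE x. x \<in> {0<..<1} \<and> I a x = 0)"

definition c :: "real \<Rightarrow> real" where
  "c a = - J a (ell a) / deriv (I a) (ell a)"

end

theory Submission
  imports Defs
begin

text \<open>
  Let \<open>w\<^sub>k = k powr (a - 1)\<close>. The scaled increments \<open>g(r) = W \<Delta>(r)\<close> satisfy
  \<open>g(r + 1) - g(r) = (r powr a - (\<Sum>k>r. w\<^sub>k)) / r\<close>. The bracket increases with \<open>r\<close> and \<open>g(n) < 0\<close>, so \<open>g\<close>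
  changes sign at most once, from plus to minus. The same shape for
  \<open>x I'(x) = x powr a - P(x)\<close>, where \<open>P(x)\<close> is the integral of \<open>y powr (a - 1)\<close> over \<open>[x, 1]\<close>,
  makes the zero of \<open>I\<close> unique (Rolle, using \<open>I(1) = 0\<close>).

  At the zero \<open>\<ell>\<close>, with \<open>L = - ln \<ell>\<close> and \<open>Q\<close> the integral of \<open>y powr (a - 2)\<close> over \<open>[\<ell>, 1]\<close>, one has
  \<open>L - 1 = P - \<ell> powr a\<close>, \<open>(1 + a) P = L\<close>, \<open>- \<ell> I'(\<ell>) = L - 1\<close> and
  \<open>2 J(\<ell>) = (L - 1)(1 + 1 / \<ell>) - Q\<close>. So \<open>c < 1/2\<close> means \<open>L - 1 < Q\<close>, which follows from \<open>P \<le> Q\<close>,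
  and \<open>c > 0\<close> means \<open>Q < (L - 1)(1 + 1 / \<ell>)\<close>, which follows by bounding \<open>1 / y\<close> by its chord as a
  convex function of \<open>ln y\<close> on \<open>[\<ell>, 1]\<close>.

  Applying the trapezoidal rule to the inner harmonic sums and to the outer sums gives
  \<open>D(r) = n I(r / n) + J(r / n) + O(1 / n)\<close>, and a Taylor expansion at \<open>\<ell>\<close> gives part 3. Since \<open>D\<close> then
  has opposite signs at distance at most 3 on either side of \<open>\<ell> n\<close>, part 3 locates the maximizer.
\<close>

section \<open>Increments and unimodality\<close>

definition harm_seg :: "nat \<Rightarrow> nat \<Rightarrow> real" where
  "harm_seg r k = (\<Sum>j=r..<k. 1 / real j)"

definition tail :: "real \<Rightarrow> nat \<Rightarrow> nat \<Rightarrow> real" where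
  "tail a n r = (\<Sum>k\<in>{r<..n}. real k powr (a - 1))"

definition harm_tail :: "real \<Rightarrow> nat \<Rightarrow> nat \<Rightarrow> real" where
  "harm_tail a n r = (\<Sum>k\<in>{r<..n}. real k powr (a - 1) * harm_seg r k)"

text \<open>For \<open>1 \<le> r \<le> n\<close> this is \<open>W a n * Delta a n r\<close>, written
  so that the separate formula for \<open>V a n 0\<close> no longer shows.\<close>

definition gap :: "real \<Rightarrow> nat \<Rightarrow> nat \<Rightarrow> real" where
  "gap a n r = harm_tail a n r - tail a n (r - 1)"

lemma W_pos: "n \<ge> 1 \<Longrightarrow> W a n > 0"
  unfolding W_def by (rule sum_pos) auto

lemma W_mult_V_zero: "n \<ge> 1 \<Longrightarrow> W a n * V a n 0 = tail a n 0"
proof -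
  have "{1..n} = {0<..n}" by auto
  then show "n \<ge> 1 \<Longrightarrow> W a n * V a n 0 = tail a n 0"
    using W_pos[of n a] by (simp add: V_def tail_def)
qed

lemma W_mult_V: 
  assumes "n \<ge> 1" "r \<ge> 1"
  shows "W a n * V a n r = real r * harm_tail a n r"
proof -
  have "(\<Sum>k=r+1..n. real k powr a * (real r / real k) * (\<Sum>j=r..k-1. 1 / real j))
      = (\<Sum>k\<in>{r<..n}. real r * (real k powr (a - 1) * harm_seg r k))"
  proof (rule sum.cong)
    show "{r+1..n} = {r<..n}" by auto
  next
    fix k assume k: "k \<in> {r<..n}"
    have "{r..k-1} = {r..<k}" using k by auto
    moreover have "real k powr a / real k = real k powr (a - 1)"
      using k by (simp add: powr_diff)
    ultimately show "real k powr a * (real r / real k) * (\<Sum>j=r..k-1. 1 / real j)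
        = real r * (real k powr (a - 1) * harm_seg r k)"
      unfolding harm_seg_def by (metis (no_types, lifting) mult.assoc mult.commute times_divide_eq_right)
  qed
  then show ?thesis
    using assms W_pos[of n a] by (simp add: V_def harm_tail_def sum_distrib_left)
qed

text \<open>The summand \<open>j = r\<close> is split off every inner sum. The outer term
  \<open>k = Suc r\<close> then carries an empty inner sum and drops out.\<close>

lemma harm_tail_Suc:
  assumes "r \<ge> 1"
  shows "harm_tail a n r = harm_tail a n (Suc r) + tail a n r / real r"
proof -
  have seg: "harm_seg r k = 1 / real r + harm_seg (Suc r) k" if "k \<in> {r<..n}" for k
    unfolding harm_seg_def using that by (auto intro: sum.atLeast_Suc_lessThan)
  have "harm_tail a n r = (\<Sum>k\<in>{r<..n}. real k powr (a - 1) * harm_seg (Suc r) k) + tail a n r / real r"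
    unfolding harm_tail_def tail_def sum_divide_distrib sum.distrib[symmetric]
    by (rule sum.cong[OF refl]) (simp add: seg distrib_left)
  also have "(\<Sum>k\<in>{r<..n}. real k powr (a - 1) * harm_seg (Suc r) k) = harm_tail a n (Suc r)"
    unfolding harm_tail_def
    by (rule sum.mono_neutral_right) (auto simp: harm_seg_def)
  finally show ?thesis .
qed

lemma tail_pred:
  assumes "1 \<le> r" "r \<le> n"
  shows "tail a n (r - 1) = real r powr (a - 1) + tail a n r"
proof -
  have "{r - 1<..n} = insert r {r<..n}" using assms by auto
  then show ?thesis by (simp add: tail_def)
qed

text \<open>Summation by parts: \<open>r H(r) - s H(s)\<close> with \<open>s = r - 1\<close> loses
  exactly \<open>tail a n s\<close> by \<open>harm_tail_Suc\<close>. The case \<open>r = 1\<close>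
  stands apart because \<open>V a n 0\<close> has its own formula, but that formula is
  \<open>tail a n 0\<close> and fits the same pattern.\<close>

lemma Delta_eq_gap:
  assumes "1 \<le> r" "r \<le> n"
  shows "W a n * Delta a n r = gap a n r"
proof (cases "r = 1")
  case True
  have "W a n * Delta a n r = W a n * V a n 1 - W a n * V a n 0"
    by (simp add: True Delta_def right_diff_distrib)
  then show ?thesis
    using assms W_mult_V[of n 1 a] W_mult_V_zero[of n a] True by (simp add: gap_def)
next
  case False
  then obtain s where s: "r = Suc s" "s \<ge> 1" using assms by (cases r) auto
  have "W a n * Delta a n r = W a n * V a n r - W a n * V a n s"
    by (simp add: s Delta_def right_diff_distrib)
  also have "\<dots> = real r * harm_tail a n r - real s * harm_tail a n s"
    using assms s by (simp add: W_mult_V)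
  also have "real s * harm_tail a n s = real s * harm_tail a n r + tail a n s"
    using harm_tail_Suc[of s a n] s by (simp add: field_simps)
  finally show ?thesis using s by (simp add: gap_def algebra_simps)
qed

lemma gap_Suc:
  assumes "1 \<le> r" "r < n"
  shows "gap a n (Suc r) - gap a n r = (real r powr a - tail a n r) / real r"
proof -
  have "real r powr (a - 1) = real r powr a / real r"
    using assms by (simp add: powr_diff)
  then show ?thesis
    using harm_tail_Suc[of r a n] tail_pred[of r n a] assms
    by (simp add: gap_def diff_divide_distrib)
qed

lemma gap_last_neg:
  assumes "n \<ge> 1" shows "gap a n n < 0"
  using tail_pred[of n n a] assms by (simp add: gap_def harm_tail_def tail_def)

text \<open>If the bracket \<open>r powr a - tail a n r\<close> is negative, the next increment of
  \<open>gap\<close> is negative. Otherwise the bracket stays nonnegative from \<open>r\<close> on,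
  so \<open>gap\<close> is nondecreasing up to its last value, which is negative.\<close>

lemma gap_Suc_neg:
  assumes a: "a \<ge> 0" and r: "1 \<le> r" "r < n" and neg: "gap a n r \<le> 0"
  shows "gap a n (Suc r) < 0"
proof (cases "real r powr a < tail a n r")
  case True
  then have "gap a n (Suc r) - gap a n r < 0"
    using gap_Suc[OF r, of a] r by (simp add: divide_neg_pos)
  then show ?thesis using neg by simp
next
  case False
  have incr: "gap a n s \<le> gap a n (Suc s)" if s: "Suc r \<le> s" "s < n" for s
  proof -
    have "tail a n s \<le> tail a n r"
      unfolding tail_def by (rule sum_mono2) (use s in auto)
    also have "\<dots> \<le> real r powr a" using False by simp
    also have "\<dots> \<le> real s powr a" using a s by (intro powr_mono2) auto
    finally have "0 \<le> gap a n (Suc s) - gap a n s"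
      using gap_Suc[of s n a] s r by simp
    then show ?thesis by simp
  qed
  have "gap a n (Suc r) \<le> gap a n s" if "Suc r \<le> s" "s \<le> n" for s
    using that
  proof (induction s rule: dec_induct)
    case (step s)
    then show ?case using incr[of s] by simp
  qed simp
  from this[of n] have "gap a n (Suc r) \<le> gap a n n" using r by simp
  then show ?thesis using gap_last_neg[of n a] r by linarith
qed

lemma gap_neg_mono:
  assumes a: "a \<ge> 0" and "1 \<le> r" "r \<le> s" "s \<le> n" and neg: "gap a n r < 0"
  shows "gap a n s < 0"
  using \<open>r \<le> s\<close> \<open>s \<le> n\<close>
proof (induction s rule: dec_induct)
  case (step s)
  then show ?case using gap_Suc_neg[of a s n] assms by simp
qed (use neg in simp)

lemma gap_sign_change:
  assumes a: "a \<ge> 0"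
  obtains m where "m \<le> n" "\<And>r. 1 \<le> r \<Longrightarrow> r \<le> m \<Longrightarrow> 0 \<le> gap a n r"
    "\<And>r. m < r \<Longrightarrow> r \<le> n \<Longrightarrow> gap a n r < 0"
proof -
  \<comment> \<open>The extra element 0 makes the maximum meaningful when \<open>gap\<close> is
    negative throughout; then \<open>m = 0\<close>.\<close>
  define S where "S = insert 0 {r \<in> {1..n}. 0 \<le> gap a n r}"
  have fin: "finite S" "S \<noteq> {}" by (auto simp: S_def)
  have "Max S \<in> S" using fin by (rule Max_in)
  moreover have "r \<le> Max S" if "r \<in> S" for r using fin that by simp
  ultimately show thesis
  proof (intro that[of "Max S"])
    show "Max S \<le> n" using \<open>Max S \<in> S\<close> by (auto simp: S_def)
  next
    fix r assume r: "1 \<le> r" "r \<le> Max S"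
    then have "Max S \<le> n" "0 \<le> gap a n (Max S)" using \<open>Max S \<in> S\<close> unfolding S_def by auto
    then show "0 \<le> gap a n r" using gap_neg_mono[OF a r] by fastforce
  next
    fix r assume r: "Max S < r" "r \<le> n"
    then have "r \<notin> S" using \<open>\<And>r. r \<in> S \<Longrightarrow> r \<le> Max S\<close> by (meson not_le)
    then show "gap a n r < 0" using r unfolding S_def by auto
  qed
qed

section \<open>Unimodality and the largest maximizer\<close>

lemma V_le_iff_gap:
  assumes "r < n"
  shows "V a n r \<le> V a n (Suc r) \<longleftrightarrow> 0 \<le> gap a n (Suc r)"
proof -
  have "W a n > 0" using assms W_pos[of n a] by simp
  moreover have "gap a n (Suc r) = W a n * (V a n (Suc r) - V a n r)"
    using Delta_eq_gap[of "Suc r" n a] assms by (simp add: Delta_def)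
  ultimately show ?thesis by (simp add: zero_le_mult_iff)
qed

text \<open>The sign change \<open>m\<close> of \<open>gap\<close> serves as both ends of the
  plateau. The descent after \<open>m\<close> is strict, so \<open>m\<close> is the largest
  maximizer; the last claim turns locating it into a question about the sign of
  \<open>gap\<close>.\<close>

lemma unimodal_V_r_opt:
  assumes a: "a \<ge> 0"
  shows "unimodal n (V a n)"
    and "r_opt a n \<le> n"
    and "\<And>r. 1 \<le> r \<Longrightarrow> r \<le> n \<Longrightarrow> r \<le> r_opt a n \<longleftrightarrow> 0 \<le> gap a n r"
proof -
  obtain m where m: "m \<le> n" and pos: "\<And>r. 1 \<le> r \<Longrightarrow> r \<le> m \<Longrightarrow> 0 \<le> gap a n r"
    and neg: "\<And>r. m < r \<Longrightarrow> r \<le> n \<Longrightarrow> gap a n r < 0"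
    using gap_sign_change[OF a] by metis
  have up: "V a n r \<le> V a n (Suc r)" if "r < m" for r
    using V_le_iff_gap[of r n a] pos[of "Suc r"] that m by simp
  have down: "V a n (Suc r) < V a n r" if "m \<le> r" "r < n" for r
    using V_le_iff_gap[of r n a] neg[of "Suc r"] that by (simp add: not_le[symmetric])
  show "unimodal n (V a n)"
    unfolding unimodal_def
    by (rule exI[of _ m], rule exI[of _ m]) (use m up down in \<open>auto intro: less_imp_le\<close>)
  have le: "V a n r \<le> V a n m" if "r \<le> m" for r
    using that by (induction rule: inc_induct) (use up in \<open>auto intro: order_trans\<close>)
  have less: "V a n r < V a n m" if "Suc m \<le> r" "r \<le> n" for r
    using that
  proof (induction r rule: dec_induct)
    case base
    then show ?case using down[of m] by simp
  next
    case (step r)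
    then show ?case using down[of r] by simp
  qed
  have "r_opt a n = m"
    unfolding r_opt_def
  proof (rule Max_eqI)
    show "m \<in> {r \<in> {0..n}. \<forall>s\<in>{0..n}. V a n s \<le> V a n r}"
      using m le less by (auto simp: not_le) (meson not_less_eq_eq le less less_imp_le)
  next
    fix y assume y: "y \<in> {r \<in> {0..n}. \<forall>s\<in>{0..n}. V a n s \<le> V a n r}"
    then have "V a n m \<le> V a n y" "y \<le> n" using m by auto
    then show "y \<le> m" using less[of y] by (meson not_le not_less_eq_eq)
  qed simp
  then show "r_opt a n \<le> n"
    and "\<And>r. 1 \<le> r \<Longrightarrow> r \<le> n \<Longrightarrow> r \<le> r_opt a n \<longleftrightarrow> 0 \<le> gap a n r"
    using m pos neg by (auto simp: not_less[symmetric])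
qed

section \<open>The zero of the limit function\<close>

definition pow_int :: "real \<Rightarrow> real \<Rightarrow> real" where
  "pow_int a x = (if a = 0 then - ln x else (1 - x powr a) / a)"

text \<open>Unlike \<open>I\<close>, whose integral is over an empty interval beyond 1, this formula
  is differentiable on both sides of 1. That permits a slope argument at the right end
  point.\<close>

definition I_closed :: "real \<Rightarrow> real \<Rightarrow> real" where
  "I_closed a x = (if a = 0 then (ln x)\<^sup>2 / 2 + ln x
     else (- ln x - (1 + 1 / a) * (1 - x powr a)) / a)"

lemma continuous_on_powr_pos [continuous_intros]:
  fixes b :: real assumes "0 < x" shows "continuous_on {x..y} (\<lambda>t. t powr b)"
  using assms by (intro continuous_intros) auto

lemma pow_int_deriv:
  assumes "0 < x"
  shows "(pow_int a has_real_derivative - (x powr (a - 1))) (at x)"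
proof (cases "a = 0")
  case True
  then have "pow_int a = (\<lambda>x. - ln x)" by (simp add: pow_int_def fun_eq_iff)
  then show ?thesis
    using assms True by (auto simp: powr_minus_divide intro!: derivative_eq_intros)
next
  case False
  then have "pow_int a = (\<lambda>x. (1 - x powr a) / a)" by (simp add: pow_int_def fun_eq_iff)
  then show ?thesis
    using assms False by (auto intro!: derivative_eq_intros)
qed

lemma has_integral_powr_minus_1:
  assumes "0 < x" "x \<le> 1"
  shows "((\<lambda>y. y powr (a - 1)) has_integral pow_int a x) {x..1}"
proof -
  have "((\<lambda>y. y powr (a - 1)) has_integral (- pow_int a 1) - (- pow_int a x)) {x..1}"
  proof (intro fundamental_theorem_of_calculus)
    fix y assume "y \<in> {x..1}"
    then have "((\<lambda>y. - pow_int a y) has_real_derivative y powr (a - 1)) (at y)"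
      using DERIV_minus[OF pow_int_deriv[of y a]] assms by simp
    then show "((\<lambda>y. - pow_int a y) has_vector_derivative y powr (a - 1)) (at y within {x..1})"
      by (simp add: has_real_derivative_iff_has_vector_derivative has_vector_derivative_at_within)
  qed (use assms in auto)
  moreover have "pow_int a 1 = 0" by (simp add: pow_int_def)
  ultimately show ?thesis by simp
qed

lemma integral_powr_minus_1:
  "0 < x \<Longrightarrow> x \<le> 1 \<Longrightarrow> integral {x..1} (\<lambda>y. y powr (a - 1)) = pow_int a x"
  using has_integral_powr_minus_1 by (rule integral_unique)

lemma has_integral_I:
  assumes "0 < x" "x \<le> 1"
  shows "((\<lambda>y. y powr (a - 1) * (ln (y / x) - 1)) has_integral I_closed a x) {x..1}"
proof -
  \<comment> \<open>Antiderivative in \<open>y\<close> with \<open>x\<close> fixed, found by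
    integration by parts.\<close>
  define F where "F = (\<lambda>y. if a = 0 then (ln y)\<^sup>2 / 2 - (ln x + 1) * ln y
    else y powr a / a * (ln y - ln x - 1) - y powr a / a\<^sup>2)"
  have "((\<lambda>y. y powr (a - 1) * (ln (y / x) - 1)) has_integral F 1 - F x) {x..1}"
  proof (intro fundamental_theorem_of_calculus)
    fix y assume y: "y \<in> {x..1}"
    have "(F has_real_derivative y powr (a - 1) * (ln (y / x) - 1)) (at y within {x..1})"
      using assms y unfolding F_def
      by (cases "a = 0")
        (auto simp: powr_diff ln_div field_simps power2_eq_square intro!: derivative_eq_intros)
    then show "(F has_vector_derivative y powr (a - 1) * (ln (y / x) - 1)) (at y within {x..1})"
      by (simp add: has_real_derivative_iff_has_vector_derivative)
  qed (use assms in auto)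
  moreover have "F 1 - F x = I_closed a x"
    by (auto simp: F_def I_closed_def field_simps power2_eq_square)
  ultimately show ?thesis by simp
qed

lemma I_eq_closed: "0 < x \<Longrightarrow> x \<le> 1 \<Longrightarrow> I a x = I_closed a x"
  unfolding I_def using has_integral_I by (rule integral_unique)

text \<open>Agrees with differentiation of the integral: the moving end point contributes
  \<open>x powr (a - 1)\<close>, and the factor \<open>ln (y / x)\<close> contributes
  \<open>- pow_int a x / x\<close>.\<close>

lemma I_closed_deriv:
  assumes "0 < x"
  shows "(I_closed a has_real_derivative (x powr a - pow_int a x) / x) (at x)"
proof (cases "a = 0")
  case True
  then have "I_closed a = (\<lambda>x. (ln x)\<^sup>2 / 2 + ln x)" by (simp add: I_closed_def fun_eq_iff)
  then show ?thesis
    using assms True by (auto simp: pow_int_def field_simps intro!: derivative_eq_intros)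
next
  case False
  then have "I_closed a = (\<lambda>x. (- ln x - (1 + 1 / a) * (1 - x powr a)) / a)"
    by (simp add: I_closed_def fun_eq_iff)
  then show ?thesis
    using assms False by (auto simp: pow_int_def powr_diff field_simps intro!: derivative_eq_intros)
qed

lemma I_closed_continuous_on: "0 < x \<Longrightarrow> continuous_on {x..y} (I_closed a)"
  by (rule DERIV_continuous_on[where D = "\<lambda>x. (x powr a - pow_int a x) / x"])
     (auto intro!: has_field_derivative_at_within I_closed_deriv)

lemma I_deriv:
  assumes "0 < x" "x < 1"
  shows "(I a has_real_derivative (x powr a - pow_int a x) / x) (at x)"
  by (rule has_field_derivative_transform_within_open[OF I_closed_deriv, where S = "{0<..<1}"])
     (use assms in \<open>auto simp: I_eq_closed\<close>)

lemma powr_minus_pow_int_strict_mono: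
  assumes "a \<ge> 0" "0 < x" "x < y"
  shows "x powr a - pow_int a x < y powr a - pow_int a y"
proof (cases "a = 0")
  case True
  then show ?thesis using assms by (simp add: pow_int_def)
next
  case False
  then have "x powr a < y powr a" using assms by (intro powr_less_mono2) auto
  moreover from this have "(1 - y powr a) / a < (1 - x powr a) / a"
    using False assms by (intro divide_strict_right_mono) auto
  ultimately show ?thesis using False by (simp add: pow_int_def)
qed

section \<open>Existence and uniqueness of the zero\<close>

lemma I_closed_1 [simp]: "I_closed a 1 = 0"
  by (simp add: I_closed_def)

lemma I_closed_Rolle:
  assumes "0 < x" "x < y" "I_closed a x = I_closed a y"
  obtains z where "x < z" "z < y" "z powr a = pow_int a z"
proof -
  have "\<exists>z. x < z \<and> z < y \<and> (*) ((z powr a - pow_int a z) / z) = (\<lambda>v. 0)"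
  proof (rule Rolle_deriv[OF assms(2,3)])
    show "continuous_on {x..y} (I_closed a)"
      using assms by (intro I_closed_continuous_on)
  next
    fix z assume "x < z" "z < y"
    then show "(I_closed a has_derivative (*) ((z powr a - pow_int a z) / z)) (at z)"
      using I_closed_deriv[of z a] assms by (intro has_field_derivative_imp_has_derivative) auto
  qed
  then obtain z where "x < z" "z < y" "((z powr a - pow_int a z) / z) * 1 = 0" by metis
  then show thesis using assms that[of z] by auto
qed

lemma I_closed_pos_exists:
  assumes "a \<ge> 0"
  obtains x where "0 < x" "x < 1" "0 < I_closed a x"
proof (cases "a = 0")
  case True
  \<comment> \<open>Here the value is \<open>9 / 2 - 3 > 0\<close>.\<close>
  then show thesis by (intro that[of "exp (- 3)"]) (auto simp: I_closed_def)
next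
  case False
  \<comment> \<open>Chosen so that \<open>- ln x = 2 + 1 / a\<close> exceeds
    \<open>1 + 1 / a\<close>, an upper bound for the subtracted product.\<close>
  define x where "x = exp (- (2 + 1 / a))"
  have a: "a > 0" using False assms by simp
  have "0 < 2 + 1 / a" using a by (intro add_pos_pos) auto
  then have "0 < x" "x < 1" by (auto simp: x_def)
  have "(1 + 1 / a) * (1 - x powr a) \<le> (1 + 1 / a) * 1"
    using a by (intro mult_left_mono) auto
  then have "0 < - ln x - (1 + 1 / a) * (1 - x powr a)"
    by (simp add: x_def)
  then show thesis using that[of x] a \<open>0 < x\<close> \<open>x < 1\<close> by (simp add: I_closed_def)
qed

text \<open>Two zeros below 1, together with the zero at 1, would give two critical points. These
  are zeros of the strictly increasing function \<open>z powr a - pow_int a z\<close>, which has at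
  most one.\<close>

lemma I_closed_zero_unique:
  assumes "a \<ge> 0" "0 < x" "x < 1" "0 < y" "y < 1" "I_closed a x = 0" "I_closed a y = 0"
  shows "x = y"
proof -
  have False if xy: "0 < x" "x < y" "y < 1" "I_closed a x = 0" "I_closed a y = 0" for x y
  proof -
    obtain z where "x < z" "z < y" "z powr a = pow_int a z"
      using xy by (metis I_closed_Rolle)
    moreover obtain z' where "y < z'" "z' < 1" "z' powr a = pow_int a z'"
      using xy by (metis I_closed_Rolle I_closed_1 order.strict_trans)
    ultimately show False
      using powr_minus_pow_int_strict_mono[of a z z'] assms(1) xy by simp
  qed
  then show ?thesis using assms by (metis linorder_less_linear)
qed

lemma I_closed_zero_exists:
  assumes "a \<ge> 0"
  obtains x where "0 < x" "x < 1" "I_closed a x = 0"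
proof -
  obtain u where u: "0 < u" "u < 1" "0 < I_closed a u"
    using I_closed_pos_exists[OF assms] .
  \<comment> \<open>Slope 1 at the zero 1 makes the function negative just to the left of 1, which
    supplies the second sign for the intermediate value theorem.\<close>
  have "(I_closed a has_real_derivative 1) (at 1)"
    using I_closed_deriv[of 1 a] by (simp add: pow_int_def split: if_splits)
  then obtain d where d: "d > 0" "\<And>h. 0 < h \<Longrightarrow> h < d \<Longrightarrow> I_closed a (1 - h) < 0"
    using DERIV_pos_inc_left[of "I_closed a" 1 1] by auto
  define h where "h = min (d / 2) ((1 - u) / 2)"
  have h: "0 < h" "h < d" "u \<le> 1 - h" using d u by (auto simp: h_def min_def field_simps)
  have "\<exists>x. u \<le> x \<and> x \<le> 1 - h \<and> I_closed a x = 0"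
  proof (rule IVT2')
    show "continuous_on {u..1 - h} (I_closed a)"
      using u by (intro I_closed_continuous_on)
  qed (use d(2)[of h] h u in auto)
  then show thesis using that u h by (metis add.commute less_add_same_cancel2 less_diff_eq order.strict_trans1 order.strict_trans2 diff_add_cancel)
qed

lemma ex1_I_zero:
  assumes "a \<ge> 0"
  shows "\<exists>!x. x \<in> {0<..<1} \<and> I a x = 0"
proof -
  obtain x where x: "0 < x" "x < 1" "I_closed a x = 0" using I_closed_zero_exists[OF assms] .
  show ?thesis
    by (rule ex1I[of _ x]) (use x I_closed_zero_unique[OF assms] in \<open>auto simp: I_eq_closed\<close>)
qed

section \<open>Identities at the zero and the bounds on \<open>c a\<close>\<close>

lemma ell_props:
  assumes "a \<ge> 0"
  shows "0 < ell a" "ell a < 1" "I_closed a (ell a) = 0" "I a (ell a) = 0"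
proof -
  have "ell a \<in> {0<..<1} \<and> I a (ell a) = 0"
    unfolding ell_def by (rule theI'[OF ex1_I_zero[OF assms]])
  then show "0 < ell a" "ell a < 1" "I_closed a (ell a) = 0" "I a (ell a) = 0"
    using I_eq_closed[of "ell a" a] by auto
qed

text \<open>Rolle between \<open>ell a\<close> and 1 gives a critical point to the right of
  \<open>ell a\<close>; the increasing bracket is therefore negative at \<open>ell a\<close>. This
  is what makes the derivative of \<open>I a\<close> negative there.\<close>

lemma ell_powr_less_pow_int:
  assumes "a \<ge> 0"
  shows "ell a powr a < pow_int a (ell a)"
proof -
  note ell = ell_props[OF assms]
  obtain z where "ell a < z" "z < 1" "z powr a = pow_int a z"
    using I_closed_Rolle[of "ell a" 1 a] ell by auto
  then show ?thesis using powr_minus_pow_int_strict_mono[of a "ell a" z] assms ell by simp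
qed

text \<open>For \<open>a = 0\<close> the equation factors as \<open>ln x * (ln x + 2) = 0\<close>,
  and the root \<open>x = 1\<close> is excluded. Otherwise it reads
  \<open>- ln x = (1 + 1 / a) * (1 - x powr a)\<close>, and
  \<open>1 - x powr a = a * pow_int a x\<close> yields both identities.\<close>

lemma ell_log:
  assumes "a \<ge> 0"
  shows "- ln (ell a) - 1 = pow_int a (ell a) - ell a powr a"
    and "pow_int a (ell a) * (1 + a) = - ln (ell a)"
    and "a = 0 \<Longrightarrow> ln (ell a) = - 2"
proof -
  note ell = ell_props[OF assms]
  show *: "ln (ell a) = - 2" if "a = 0"
  proof -
    have "ln (ell a) * (ln (ell a) + 2) = 0"
      using ell(3) that by (simp add: I_closed_def power2_eq_square algebra_simps)
    moreover have "ln (ell a) < 0" using ell by simp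
    ultimately show ?thesis by auto
  qed
  have **: "- ln (ell a) = (1 + 1 / a) * (1 - ell a powr a)" if "a \<noteq> 0"
    using ell(3) that by (simp add: I_closed_def)
  show "- ln (ell a) - 1 = pow_int a (ell a) - ell a powr a"
    using * ** ell(1) by (cases "a = 0") (auto simp: pow_int_def field_simps)
  show "pow_int a (ell a) * (1 + a) = - ln (ell a)"
    using * ** ell(1) by (cases "a = 0") (auto simp: pow_int_def field_simps)
qed

lemma ell_log_gt_1: "a \<ge> 0 \<Longrightarrow> - ln (ell a) > 1"
  using ell_log(1)[of a] ell_powr_less_pow_int[of a] by simp

lemma deriv_I_ell:
  assumes "a \<ge> 0"
  shows "deriv (I a) (ell a) = (1 + ln (ell a)) / ell a"
proof -
  have "ell a powr a - pow_int a (ell a) = 1 + ln (ell a)" using ell_log(1)[OF assms] by simp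
  then show ?thesis
    using DERIV_imp_deriv[OF I_deriv] ell_props[OF assms] by simp
qed

lemma deriv_I_ell_neg: "a \<ge> 0 \<Longrightarrow> deriv (I a) (ell a) < 0"
  using ell_log_gt_1[of a] ell_props[of a] by (simp add: deriv_I_ell divide_neg_pos)

text \<open>Substituting \<open>pow_int a (ell a)\<close> from \<open>ell_log\<close> cancels the
  term \<open>ell a powr (a - 1)\<close> of \<open>J\<close>.\<close>

lemma J_ell:
  assumes "a \<ge> 0"
  shows "2 * J a (ell a) = (- ln (ell a) - 1) * (1 + 1 / ell a) - integral {ell a..1} (\<lambda>y. y powr (a - 2))"
proof -
  note ell = ell_props[OF assms]
  have "ell a powr (a - 1) = ell a powr a / ell a" using ell by (simp add: powr_diff)
  moreover have P: "pow_int a (ell a) = - ln (ell a) - 1 + ell a powr a"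
    using ell_log(1)[OF assms] by simp
  ultimately show ?thesis
    using ell(1,2) unfolding J_def
    by (simp add: integral_powr_minus_1 P ln_div add_divide_distrib diff_divide_distrib algebra_simps)
qed

lemma pow_int_le_integral:
  assumes "0 < x" "x \<le> 1"
  shows "pow_int a x \<le> integral {x..1} (\<lambda>y. y powr (a - 2))"
proof -
  have "integral {x..1} (\<lambda>y. y powr (a - 1)) \<le> integral {x..1} (\<lambda>y. y powr (a - 2))"
    using assms by (intro integral_le integrable_continuous_real continuous_intros)
      (auto intro: powr_mono')
  then show ?thesis using assms by (simp add: integral_powr_minus_1)
qed

lemma J_ell_less:
  assumes "a \<ge> 0"
  shows "J a (ell a) < - deriv (I a) (ell a) / 2"
proof -
  note ell = ell_props[OF assms]
  have "- ln (ell a) - 1 < pow_int a (ell a)" using ell_log(1)[OF assms] ell(1) by simp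
  also have "\<dots> \<le> integral {ell a..1} (\<lambda>y. y powr (a - 2))"
    using ell by (intro pow_int_le_integral) auto
  finally have "2 * J a (ell a) < (- ln (ell a) - 1) / ell a"
    unfolding J_ell[OF assms] by (simp add: distrib_left)
  moreover have "(- ln (ell a) - 1) / ell a = - deriv (I a) (ell a)"
    by (simp add: deriv_I_ell[OF assms] minus_divide_left)
  ultimately show ?thesis by simp
qed

text \<open>With \<open>s = - a ln \<ell>\<close>, the equation for \<open>\<ell>\<close> reads \<open>(1 + a - s) e\<^sup>s = 1 + a\<close>; expand \<open>e\<^sup>s\<close> to second order.\<close>

lemma ell_log_lower_bound:
  assumes "a \<ge> 0"
  shows "1 \<le> (- ln (ell a) - 1) * (1 - a * ln (ell a))"
proof (cases "a = 0")
  case True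
  then show ?thesis using ell_log(3)[OF assms] by simp
next
  case False
  then have a: "a > 0" using assms by simp
  note ell = ell_props[OF assms]
  define L where "L = - ln (ell a)"
  define s where "s = a * L"
  have L: "L > 1" using ell_log_gt_1[OF assms] by (simp add: L_def)
  have p: "ell a powr a = exp (- s)"
    using ell by (simp add: powr_def s_def L_def)
  have 1: "(1 - exp (- s)) * (1 + a) = s"
    using ell_log(2)[OF assms] a by (simp add: pow_int_def p L_def s_def field_simps)
  have "s > 0" using a L by (simp add: s_def)
  have "(1 + a - s) * exp s = 1 + a"
  proof -
    have "1 + a - (1 - e) * (1 + a) = e * (1 + a)" for e
      by (simp add: algebra_simps)
    from this[of "exp (- s)"] have "1 + a - s = exp (- s) * (1 + a)" unfolding 1 .
    then have "(1 + a - s) * exp s = (exp (- s) * exp s) * (1 + a)"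
      by (simp only: mult.commute mult.left_commute)
    then show ?thesis by (simp add: exp_minus)
  qed
  \<comment> \<open>Positivity of this factor preserves the Taylor inequality under
    multiplication.\<close>
  moreover have "1 + a - s > 0"
    using 1 a by (smt (verit) exp_gt_zero mult_less_cancel_right2)
  moreover have "1 + s + s\<^sup>2 / 2 \<le> exp s" using exp_lower_Taylor_quadratic[of s] \<open>s > 0\<close> by simp
  ultimately have "(1 + a - s) * (1 + s + s\<^sup>2 / 2) \<le> 1 + a"
    by (metis less_imp_le mult_left_mono)
  moreover have "(1 + a - s) * (1 + s + s\<^sup>2 / 2)
      = 1 + a + s * ((1 + a) * (1 + s / 2)) - s * (1 + s + s\<^sup>2 / 2)"
    by (simp add: field_simps power2_eq_square)
  ultimately have "s * ((1 + a) * (1 + s / 2)) \<le> s * (1 + s + s\<^sup>2 / 2)"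
    by simp
  \<comment> \<open>After cancelling \<open>s\<close>, twice the difference of the two sides is
    \<open>a\<close> times the difference in the claim.\<close>
  then have "0 \<le> 2 * ((1 + s + s\<^sup>2 / 2) - (1 + a) * (1 + s / 2))" using \<open>s > 0\<close> by simp
  also have "2 * ((1 + s + s\<^sup>2 / 2) - (1 + a) * (1 + s / 2)) = a * ((L - 1) * (1 + a * L)) - a * 1"
    by (simp add: s_def field_simps power2_eq_square)
  finally have "a * 1 \<le> a * ((L - 1) * (1 + a * L))"
    by (rule diff_ge_0_iff_ge[THEN iffD1])
  then have "1 \<le> (L - 1) * (1 + a * L)" using a by simp
  then show ?thesis by (simp add: L_def)
qed

text \<open>\<open>1 / y = exp (- ln y)\<close> is convex in \<open>ln y\<close>. The right-hand
  side is its chord between \<open>ln x\<close> and 0, and \<open>t\<close> is the position of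
  \<open>ln y\<close> measured from 0 towards \<open>ln x\<close>.\<close>

lemma inverse_le_log_chord:
  fixes x y :: real
  assumes "0 < x" "x < 1" "x \<le> y" "y \<le> 1"
  shows "1 / y \<le> 1 + (1 / x - 1) / (- ln x) * (- ln y)"
proof -
  define t where "t = ln y / ln x"
  have lx: "ln x < 0" using assms by (intro ln_less_zero) auto
  have t: "0 \<le> t" "t \<le> 1" using assms lx by (auto simp: t_def divide_nonpos_neg divide_le_eq_1_neg ln_le_cancel_iff)
  have "exp ((1 - t) * 0 + t * (- ln x)) \<le> (1 - t) * exp 0 + t * exp (- ln x)"
    using convex_onD[OF exp_convex t, of 0 "- ln x"] by simp
  also have "(1 - t) * 0 + t * (- ln x) = - ln y" using lx by (simp add: t_def)
  finally have "1 / y \<le> (1 - t) + t / x" using assms by (simp add: exp_minus inverse_eq_divide)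
  also have "\<dots> = 1 + (1 / x - 1) / (- ln x) * (- ln y)"
    using lx by (simp add: t_def field_simps)
  finally show ?thesis .
qed

lemma J_ell_pos:
  assumes "a \<ge> 0"
  shows "0 < J a (ell a)"
proof -
  note ell = ell_props[OF assms]
  define x where "x = ell a"
  define L where "L = - ln x"
  define P where "P = pow_int a x"
  define Q where "Q = integral {x..1} (\<lambda>y. y powr (a - 2))"
  have x: "0 < x" "x < 1" using ell by (simp_all add: x_def)
  have L: "L > 1" using ell_log_gt_1[OF assms] by (simp add: L_def x_def)
  have P: "P * (1 + a) = L" using ell_log(2)[OF assms] by (simp add: P_def L_def x_def)
  have hP: "((\<lambda>y. y powr (a - 1)) has_integral P) {x..1}"
    unfolding P_def using x by (intro has_integral_powr_minus_1) auto
  \<comment> \<open>The equation \<open>I a x = 0\<close> evaluates the logarithmic moment as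
    \<open>P * (L - 1)\<close>, which is what integrating the chord bound requires.\<close>
  have "((\<lambda>y. y powr (a - 1) * (ln (y / x) - 1)) has_integral 0) {x..1}"
    using has_integral_I[of x a] x ell by (simp add: x_def)
  from has_integral_diff[OF has_integral_mult_left[OF hP, of "L - 1"] this]
  have "((\<lambda>y. y powr (a - 1) * (L - 1) - y powr (a - 1) * (ln (y / x) - 1)) has_integral P * (L - 1)) {x..1}"
    by simp
  then have hB: "((\<lambda>y. y powr (a - 1) * (- ln y)) has_integral P * (L - 1)) {x..1}"
    by (rule has_integral_eq[rotated]) (use x in \<open>auto simp: L_def ln_div algebra_simps\<close>)
  have hR: "((\<lambda>y. y powr (a - 1) + y powr (a - 1) * (- ln y) * ((1 / x - 1) / L)) has_integral
      P + P * (L - 1) * ((1 / x - 1) / L)) {x..1}"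
    by (intro has_integral_add has_integral_mult_left hP hB)
  have hQ: "((\<lambda>y. y powr (a - 2)) has_integral Q) {x..1}"
    unfolding Q_def using x by (intro integrable_integral integrable_continuous_real continuous_intros)
  have "Q \<le> P + P * (L - 1) * ((1 / x - 1) / L)"
  proof (rule has_integral_le[OF hQ hR])
    fix y assume y: "y \<in> {x..1}"
    have "y powr (a - 2) = y powr (a - 1) * (1 / y)"
      using x y by (simp add: powr_diff power2_eq_square field_simps flip: powr_realpow)
    also have "\<dots> \<le> y powr (a - 1) * (1 + (1 / x - 1) / L * (- ln y))"
      using inverse_le_log_chord[of x y] x y by (intro mult_left_mono) (auto simp: L_def)
    finally show "y powr (a - 2) \<le> y powr (a - 1) + y powr (a - 1) * (- ln y) * ((1 / x - 1) / L)"
      by (simp only: distrib_left mult_1_right ac_simps)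
  qed
  then have "(1 + a) * Q \<le> (1 + a) * (P + P * (L - 1) * ((1 / x - 1) / L))"
    using assms by (intro mult_left_mono) auto
  also have "\<dots> = (P * (1 + a)) * (1 + (L - 1) * ((1 / x - 1) / L))"
    by (simp only: distrib_left distrib_right mult_1_left mult_1_right ac_simps)
  also have "\<dots> = L + (L - 1) * (1 / x - 1)"
    unfolding P using L by (simp add: distrib_left)
  finally have Q: "(1 + a) * Q \<le> L + (L - 1) * (1 / x - 1)" .
  have bound: "1 \<le> (L - 1) * (1 + a * L)"
    using ell_log_lower_bound[OF assms] by (simp add: L_def x_def)
  show ?thesis
  proof (cases "a = 0")
    \<comment> \<open>For \<open>a = 0\<close> the bound
      \<open>1 \<le> (L - 1) * (1 + a * L)\<close> is an equality and yields no strict inequality,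
      so \<open>Q\<close> is computed outright.\<close>
    case True
    have "((\<lambda>y. y powr (-2)) has_integral (- 1 / 1) - (- 1 / x)) {x..1}"
      using x
      by (intro fundamental_theorem_of_calculus)
        (auto simp: has_real_derivative_iff_has_vector_derivative[symmetric] powr_minus field_simps power2_eq_square
          intro!: derivative_eq_intros)
    then have "Q = 1 / x - 1" using True by (simp add: Q_def integral_unique)
    moreover have "L = 2"
      using ell_log(3)[OF assms True] by (simp add: L_def x_def)
    ultimately show ?thesis
      using J_ell[OF assms] unfolding x_def[symmetric] Q_def[symmetric] by (simp add: L_def)
  next
    case False
    \<comment> \<open>Since \<open>1 / x = exp L\<close>, replacing \<open>L\<close> by
      \<open>1 / x + 1\<close> in \<open>bound\<close> makes it strict.\<close>
    have "L + 1 \<le> 1 / x"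
      using exp_ge_add_one_self[of L] x by (simp add: L_def exp_minus inverse_eq_divide)
    then have "a * L < a * (1 / x + 1)" using False assms by (intro mult_strict_left_mono) auto
    then have "(L - 1) * (1 + a * L) < (L - 1) * (1 + a * (1 / x + 1))"
      using L by (intro mult_strict_left_mono) auto
    then have "1 < (L - 1) * (1 + a * (1 / x + 1))" using bound by simp
    moreover have "(1 + a) * ((L - 1) * (1 + m)) = L + (L - 1) * (m - 1) + (L - 1) * (1 + a * (m + 1)) - 1" for m
      by algebra
    ultimately have "(1 + a) * Q < (1 + a) * ((L - 1) * (1 + 1 / x))"
      using Q by simp
    then have "Q < (L - 1) * (1 + 1 / x)" using assms by simp
    then show ?thesis
      using J_ell[OF assms] unfolding x_def[symmetric] Q_def[symmetric] by (simp add: L_def)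
  qed
qed

lemma c_bounds:
  assumes "a \<ge> 0"
  shows "0 < c a" "c a < 1 / 2"
  using J_ell_pos[OF assms] J_ell_less[OF assms] deriv_I_ell_neg[OF assms]
  by (auto simp: c_def divide_pos_neg field_simps)

section \<open>Trapezoidal sums\<close>

lemma integral_lower_deriv:
  fixes g :: "real \<Rightarrow> real"
  assumes g: "continuous_on {0<..} g" and x: "0 < x" "x < y"
  shows "((\<lambda>x. integral {x..y} g) has_real_derivative - g x) (at x)"
proof -
  have "((\<lambda>x. integral {x..y} g) has_real_derivative - g x) (at x within {x / 2..y})"
    using x by (intro integral_has_real_derivative' continuous_on_subset[OF g]) auto
  moreover have "at x within {x / 2..y} = at x"
    using x by (intro at_within_interior) auto
  ultimately show ?thesis by simp
qed

text \<open>Supplies ordinary two-sided derivatives on an open interval; applied to one containing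
  \<open>[d, 1]\<close>, it lets \<open>trapezoid_step\<close> be used up to the end points.\<close>

lemma real_antiderivative:
  fixes g :: "real \<Rightarrow> real"
  assumes g: "continuous_on {0<..} g" and d: "0 < d"
  obtains F where "\<And>x. d < x \<Longrightarrow> x < e \<Longrightarrow> (F has_real_derivative g x) (at x)"
proof -
  have cont: "continuous_on {d..e} g"
    by (rule continuous_on_subset[OF g]) (use d in auto)
  define F where "F = (\<lambda>u. integral {d..u} g)"
  have F: "(F has_vector_derivative g x) (at x within {d..e})" if "x \<in> {d..e}" for x
    unfolding F_def using cont that by (rule integral_has_vector_derivative)
  have "(F has_real_derivative g x) (at x)" if "d < x" "x < e" for x
  proof -
    have "at x within {d..e} = at x" using that by (intro at_within_interior) auto
    then show ?thesis using F[of x] that by (simp add: has_real_derivative_iff_has_vector_derivative)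
  qed
  then show thesis by (rule that)
qed

text \<open>The error is viewed as a function \<open>E\<close> of the right end point. It vanishes
  at \<open>p\<close>, and two mean value steps express its derivative through \<open>g2\<close>.
  The constant is 1 rather than the sharp \<open>1 / 12\<close>.\<close>

lemma trapezoid_step:
  fixes F g g1 g2 :: "real \<Rightarrow> real"
  assumes "p < q"
    and F: "\<And>x. p \<le> x \<Longrightarrow> x \<le> q \<Longrightarrow> (F has_real_derivative g x) (at x)"
    and g: "\<And>x. p \<le> x \<Longrightarrow> x \<le> q \<Longrightarrow> (g has_real_derivative g1 x) (at x)"
    and g1: "\<And>x. p \<le> x \<Longrightarrow> x \<le> q \<Longrightarrow> (g1 has_real_derivative g2 x) (at x)"
    and B: "\<And>x. p \<le> x \<Longrightarrow> x \<le> q \<Longrightarrow> \<bar>g2 x\<bar> \<le> B"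
  shows "\<bar>F q - F p - (q - p) / 2 * (g p + g q)\<bar> \<le> B * (q - p) ^ 3"
proof -
  define E where "E = (\<lambda>t. F t - F p - (t - p) / 2 * (g p + g t))"
  define E1 where "E1 = (\<lambda>t. (g t - g p - (t - p) * g1 t) / 2)"
  have E: "(E has_real_derivative E1 t) (at t)" if "p \<le> t" "t \<le> q" for t
    unfolding E_def E1_def using F[OF that] g[OF that]
    by (auto intro!: derivative_eq_intros simp: field_simps)
  have B0: "0 \<le> B" using B[of p] \<open>p < q\<close> by simp
  have bound: "\<bar>E1 t\<bar> \<le> B * (q - p)\<^sup>2" if t: "p < t" "t < q" for t
  proof -
    obtain u where u: "p < u" "u < t" "g t - g p = (t - p) * g1 u"
      using MVT2[of p t g g1] g t by force
    obtain v where v: "u < v" "v < t" "g1 t - g1 u = (t - u) * g2 v"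
      using MVT2[of u t g1 g2] g1 t u by force
    have "E1 t = - ((t - p) * ((t - u) * g2 v)) / 2"
      unfolding E1_def u(3) v(3)[symmetric] by (simp add: algebra_simps)
    then have "\<bar>E1 t\<bar> = ((t - p) * (t - u)) * \<bar>g2 v\<bar> / 2"
      using u t by (simp add: abs_mult)
    also have "\<dots> \<le> ((t - p) * (t - u)) * \<bar>g2 v\<bar>" using u t by simp
    also have "\<dots> \<le> ((q - p) * (q - p)) * B"
      using u v t B[of v] by (intro mult_mono) auto
    finally show ?thesis by (simp add: power2_eq_square mult.commute)
  qed
  obtain z where z: "p < z" "z < q" "E q - E p = (q - p) * E1 z"
    using MVT2[of p q E E1] E \<open>p < q\<close> by force
  have "\<bar>E q - E p\<bar> = (q - p) * \<bar>E1 z\<bar>" using z \<open>p < q\<close> by (simp add: abs_mult)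
  also have "\<dots> \<le> (q - p) * (B * (q - p)\<^sup>2)"
    using bound[of z] z \<open>p < q\<close> by (intro mult_left_mono) auto
  finally show ?thesis by (simp add: E_def power2_eq_square power3_eq_cube mult_ac)
qed

text \<open>This is \<open>n\<close> times the error of the composite trapezoidal rule with step
  \<open>1 / n\<close>. The sum omits the left end point, so the end-point correction is half a
  difference.\<close>

definition trapezoid_error :: "(real \<Rightarrow> real) \<Rightarrow> nat \<Rightarrow> nat \<Rightarrow> nat \<Rightarrow> real" where
  "trapezoid_error g n r k = (\<Sum>j\<in>{r<..k}. g (real j / real n))
     - real n * integral {real r / real n..real k / real n} g
     - (g (real k / real n) - g (real r / real n)) / 2"

text \<open>After scaling by \<open>n\<close>, each cell of width \<open>1 / n\<close> contributes
  at most \<open>B / n^2\<close>, and there are at most \<open>n\<close> cells. Here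
  \<open>B\<close> bounds \<open>g2\<close> on the compact interval \<open>[d, 1]\<close>, hence
  does not depend on \<open>r\<close> and \<open>k\<close>.\<close>

lemma trapezoid_error_bound:
  fixes g g1 g2 :: "real \<Rightarrow> real"
  assumes g: "\<And>x. 0 < x \<Longrightarrow> (g has_real_derivative g1 x) (at x)"
    and g1: "\<And>x. 0 < x \<Longrightarrow> (g1 has_real_derivative g2 x) (at x)"
    and g2: "continuous_on {0<..} g2"
    and d: "0 < d"
  shows "\<exists>B\<ge>0. \<forall>n r k. d * real n \<le> real r \<and> r \<le> k \<and> k \<le> n \<and> 1 \<le> n \<longrightarrow>
    \<bar>trapezoid_error g n r k\<bar> \<le> B / real n"
proof -
  have "compact (g2 ` {d..1})"
    using d by (intro compact_continuous_image continuous_on_subset[OF g2]) auto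
  then obtain B where B0: "B > 0" and B': "\<forall>y\<in>g2 ` {d..1}. norm y \<le> B"
    using compact_imp_bounded bounded_pos by metis
  have B: "\<bar>g2 x\<bar> \<le> B" if "d \<le> x" "x \<le> 1" for x
    using B' that by simp
  have contg: "continuous_on {0<..} g"
    by (meson DERIV_isCont continuous_at_imp_continuous_on g greaterThan_iff)
  obtain F where F: "\<And>x. d / 2 < x \<Longrightarrow> x < 2 \<Longrightarrow> (F has_real_derivative g x) (at x)"
    using real_antiderivative[OF contg, of "d / 2" 2] d half_gt_zero by metis
  have "\<bar>trapezoid_error g n r k\<bar> \<le> B / real n"
    if r: "d * real n \<le> real r" and k: "r \<le> k" "k \<le> n" and n: "1 \<le> n" for n r k
  proof -
    have N: "real n > 0" using n by simp
    define G where "G = (\<lambda>j. F (real j / real n))"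
    define v where "v = (\<lambda>j. g (real j / real n))"
    have dr: "d \<le> real r / real n" using r N by (simp add: field_simps)
    have "integral {real r / real n..real k / real n} g = G k - G r"
      unfolding G_def
    proof (intro integral_unique fundamental_theorem_of_calculus)
      show "real r / real n \<le> real k / real n" using k N by (simp add: divide_right_mono)
      fix x assume x: "x \<in> {real r / real n..real k / real n}"
      have "real k / real n \<le> 1" using k N by simp
      then have "(F has_real_derivative g x) (at x)" using x dr d by (intro F) auto
      then show "(F has_vector_derivative g x) (at x within {real r / real n..real k / real n})"
        by (simp add: has_real_derivative_iff_has_vector_derivative has_vector_derivative_at_within)
    qed
    moreover have "\<bar>(\<Sum>j\<in>{r<..k}. v j) - real n * (G k - G r) - (v k - v r) / 2\<bar>
        \<le> real (k - r) * (B / (real n)\<^sup>2)"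
      using k
    proof (induction k rule: dec_induct)
      case (step j)
      have "\<bar>G (Suc j) - G j - (real (Suc j) / real n - real j / real n) / 2 * (v j + v (Suc j))\<bar>
          \<le> B * (real (Suc j) / real n - real j / real n) ^ 3"
        unfolding G_def v_def
      proof (rule trapezoid_step[where ?g1.0 = g1 and ?g2.0 = g2])
        fix x assume "real j / real n \<le> x" "x \<le> real (Suc j) / real n"
        moreover have "real (Suc j) / real n \<le> 1" using step N by (simp add: divide_le_eq_1)
        moreover have "real r / real n \<le> real j / real n" using step N by (simp add: divide_right_mono)
        ultimately have x: "d \<le> x" "x \<le> 1" using dr by linarith+
        then show "(F has_real_derivative g x) (at x)" "(g has_real_derivative g1 x) (at x)"
          "(g1 has_real_derivative g2 x) (at x)" "\<bar>g2 x\<bar> \<le> B"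
          using d F[of x] g[of x] g1[of x] B[of x] by auto
      qed (use N in \<open>simp add: divide_strict_right_mono\<close>)
      also have "real (Suc j) / real n - real j / real n = 1 / real n"
        by (simp flip: diff_divide_distrib)
      finally have "real n * \<bar>G (Suc j) - G j - 1 / real n / 2 * (v j + v (Suc j))\<bar> \<le> real n * (B * (1 / real n) ^ 3)"
        using N by (intro mult_left_mono) auto
      also have "real n * (B * (1 / real n) ^ 3) = B / (real n)\<^sup>2"
        using N by (simp add: field_simps power2_eq_square power3_eq_cube)
      also have "real n * \<bar>G (Suc j) - G j - 1 / real n / 2 * (v j + v (Suc j))\<bar>
          = \<bar>real n * (G (Suc j) - G j - 1 / real n / 2 * (v j + v (Suc j)))\<bar>"
        using N by (simp add: abs_mult)
      also have "real n * (G (Suc j) - G j - 1 / real n / 2 * (v j + v (Suc j)))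
          = real n * (G (Suc j) - G j) - (v j + v (Suc j)) / 2"
        using N by (simp add: field_simps)
      finally have *: "\<bar>real n * (G (Suc j) - G j) - (v j + v (Suc j)) / 2\<bar> \<le> B / (real n)\<^sup>2" .
      have "{r<..Suc j} = insert (Suc j) {r<..j}" using step by auto
      then have "(\<Sum>i\<in>{r<..Suc j}. v i) = v (Suc j) + (\<Sum>i\<in>{r<..j}. v i)" by simp
      then have "(\<Sum>i\<in>{r<..Suc j}. v i) - real n * (G (Suc j) - G r) - (v (Suc j) - v r) / 2
        = ((\<Sum>i\<in>{r<..j}. v i) - real n * (G j - G r) - (v j - v r) / 2)
          - (real n * (G (Suc j) - G j) - (v j + v (Suc j)) / 2)"
        by (simp add: right_diff_distrib add_divide_distrib diff_divide_distrib)
      then have "\<bar>(\<Sum>i\<in>{r<..Suc j}. v i) - real n * (G (Suc j) - G r) - (v (Suc j) - v r) / 2\<bar>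
        \<le> \<bar>(\<Sum>i\<in>{r<..j}. v i) - real n * (G j - G r) - (v j - v r) / 2\<bar>
          + \<bar>real n * (G (Suc j) - G j) - (v j + v (Suc j)) / 2\<bar>"
        by (metis abs_triangle_ineq4)
      also have "\<dots> \<le> real (j - r) * (B / (real n)\<^sup>2) + B / (real n)\<^sup>2"
        using step * by (intro add_mono) auto
      also have "\<dots> = (real (j - r) + 1) * (B / (real n)\<^sup>2)"
        by (simp only: distrib_right mult_1_left)
      also have "real (j - r) + 1 = real (Suc j - r)" using step by simp
      finally show ?case .
    qed simp
    moreover have "real (k - r) * (B / (real n)\<^sup>2) \<le> real n * (B / (real n)\<^sup>2)"
      using k B0 by (intro mult_right_mono) auto
    moreover have "real n * (B / (real n)\<^sup>2) = B / real n"
      using N by (simp add: power2_eq_square)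
    ultimately show ?thesis by (simp add: v_def trapezoid_error_def)
  qed
  then show ?thesis using B0 by (intro exI[of _ B]) auto
qed

lemma powr_deriv_pos: "0 < (x::real) \<Longrightarrow> ((\<lambda>y. y powr b) has_real_derivative b * x powr (b - 1)) (at x)"
  by (auto intro!: derivative_eq_intros)

lemma powr_trapezoid_error_bound:
  assumes d: "0 < d"
  shows "\<exists>B\<ge>0. \<forall>n r k. d * real n \<le> real r \<and> r \<le> k \<and> k \<le> n \<and> 1 \<le> n \<longrightarrow>
    \<bar>trapezoid_error (\<lambda>y. y powr b) n r k\<bar> \<le> B / real n"
proof (rule trapezoid_error_bound[OF _ _ _ d])
  show "((\<lambda>y. y powr b) has_real_derivative b * x powr (b - 1)) (at x)" if "0 < x" for x
    using that by (rule powr_deriv_pos)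
  show "((\<lambda>y. b * y powr (b - 1)) has_real_derivative b * ((b - 1) * x powr (b - 1 - 1))) (at x)" if "0 < x" for x
    using that by (intro DERIV_cmult powr_deriv_pos)
  show "continuous_on {0<..} (\<lambda>x. b * ((b - 1) * x powr (b - 1 - 1)))"
    by (intro continuous_intros) auto
qed

lemma powr_ln_trapezoid_error_bound:
  assumes d: "0 < d"
  shows "\<exists>B\<ge>0. \<forall>n r k. d * real n \<le> real r \<and> r \<le> k \<and> k \<le> n \<and> 1 \<le> n \<longrightarrow>
    \<bar>trapezoid_error (\<lambda>y. y powr b * ln y) n r k\<bar> \<le> B / real n"
proof (rule trapezoid_error_bound[OF _ _ _ d])
  have *: "((\<lambda>y. y powr b * ln y) has_real_derivative b * (x powr (b - 1) * ln x) + x powr (b - 1)) (at x)" if "0 < x" for b x :: real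
    using that by (auto intro!: derivative_eq_intros simp: powr_diff)
  show "((\<lambda>y. y powr b * ln y) has_real_derivative b * (x powr (b - 1) * ln x) + x powr (b - 1)) (at x)" if "0 < x" for x
    using that by (rule *)
  show "((\<lambda>x. b * (x powr (b - 1) * ln x) + x powr (b - 1)) has_real_derivative
    b * ((b - 1) * (x powr (b - 1 - 1) * ln x) + x powr (b - 1 - 1)) + (b - 1) * x powr (b - 1 - 1)) (at x)" if "0 < x" for x
    using that by (intro DERIV_add DERIV_cmult * powr_deriv_pos)
  show "continuous_on {0<..} (\<lambda>x. b * ((b - 1) * (x powr (b - 1 - 1) * ln x) + x powr (b - 1 - 1)) + (b - 1) * x powr (b - 1 - 1))"
    by (intro continuous_intros) auto
qed

section \<open>Expansion of the increments\<close>

lemma powr_le_unit_interval: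
  fixes x d b :: real
  assumes "0 < d" "d \<le> x" "x \<le> 1"
  shows "x powr b \<le> 1 + d powr b"
proof (cases "b \<ge> 0")
  case True
  then have "x powr b \<le> 1 powr b" using assms by (intro powr_mono2) auto
  then show ?thesis by (simp add: add_increasing2)
next
  case False
  then have "x powr b \<le> d powr b" using assms by (intro powr_mono2') auto
  then show ?thesis by simp
qed

text \<open>Moving \<open>ln x\<close> outside leaves integrands independent of \<open>x\<close>, so
  one trapezoidal bound covers all \<open>r\<close>.\<close>

lemma I_eq_log_moment:
  assumes "0 < x" "x \<le> 1"
  shows "I a x = integral {x..1} (\<lambda>y. y powr (a - 1) * ln y) - (ln x + 1) * integral {x..1} (\<lambda>y. y powr (a - 1))"
proof -
  have "I a x = integral {x..1} (\<lambda>y. y powr (a - 1) * ln y - (ln x + 1) * y powr (a - 1))"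
    unfolding I_def using assms by (intro integral_cong) (auto simp: ln_div algebra_simps)
  also have "\<dots> = integral {x..1} (\<lambda>y. y powr (a - 1) * ln y) - integral {x..1} (\<lambda>y. (ln x + 1) * y powr (a - 1))"
    using assms by (intro integral_diff integrable_continuous_real continuous_intros) auto
  finally show ?thesis by simp
qed

text \<open>Trapezoidal rule for \<open>1 / y\<close>, written as a power to match the general bound
  for powers.\<close>

lemma harm_seg_eq_trapezoid:
  assumes "1 \<le> r" "r \<le> k" "1 \<le> n"
  shows "harm_seg r k = ln (real k / real n) - ln (real r / real n) + (1 / real r - 1 / real k) / 2
    + trapezoid_error (\<lambda>y. y powr - 1) n r k / real n"
proof -
  have pos: "real n > 0" "real r > 0" "real k > 0" using assms by auto
  have "((\<lambda>y. y powr - 1) has_integral ln (real k / real n) - ln (real r / real n)) {real r / real n..real k / real n}"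
  proof (intro fundamental_theorem_of_calculus)
    fix y assume y: "y \<in> {real r / real n..real k / real n}"
    moreover have "0 < real r / real n" using pos by simp
    ultimately have "0 < y" by (meson atLeastAtMost_iff order.strict_trans2)
    then have "(ln has_real_derivative y powr - 1) (at y)"
      by (auto intro!: derivative_eq_intros simp: powr_minus_divide)
    then show "(ln has_vector_derivative y powr - 1) (at y within {real r / real n..real k / real n})"
      by (simp add: has_real_derivative_iff_has_vector_derivative has_vector_derivative_at_within)
  qed (use assms pos in \<open>simp add: divide_right_mono\<close>)
  then have int: "integral {real r / real n..real k / real n} (\<lambda>y. y powr - 1)
      = ln (real k / real n) - ln (real r / real n)"
    by (rule integral_unique)
  have inv: "(real j / real n) powr - 1 = real n * (1 / real j)" for j
    by (simp add: powr_minus_divide)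
  \<comment> \<open>\<open>harm_seg\<close> includes \<open>r\<close> and omits \<open>k\<close>,
    while \<open>trapezoid_error\<close> does the opposite; the shift reverses the sign of the
    end-point correction.\<close>
  have "insert r {r<..k} = insert k {r..<k}" using assms by auto
  then have "(\<Sum>j\<in>insert r {r<..k}. 1 / real j) = (\<Sum>j\<in>insert k {r..<k}. 1 / real j)" by simp
  then have "(\<Sum>j\<in>{r<..k}. 1 / real j) = harm_seg r k + 1 / real k - 1 / real r"
    unfolding harm_seg_def by simp
  moreover have "(\<Sum>j\<in>{r<..k}. (real j / real n) powr - 1) = real n * (\<Sum>j\<in>{r<..k}. 1 / real j)"
    by (simp only: inv sum_distrib_left)
  ultimately have "trapezoid_error (\<lambda>y. y powr - 1) n r k = real n * (harm_seg r k + 1 / real k - 1 / real r)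
      - real n * (ln (real k / real n) - ln (real r / real n)) - (real n * (1 / real k) - real n * (1 / real r)) / 2"
    unfolding trapezoid_error_def int by (simp only: inv)
  also have "\<dots> = real n * (harm_seg r k - (ln (real k / real n) - ln (real r / real n))
      - (1 / real r - 1 / real k) / 2)"
    by (simp only: right_diff_distrib distrib_left times_divide_eq_right diff_divide_distrib) simp
  finally show ?thesis using pos by simp
qed

lemma scaled_powr:
  assumes "n > 0"
  shows "real n powr (1 - a) * real k powr (a - 1) = (real k / real n) powr (a - 1)"
  using assms powr_minus_divide[of "real n" "a - 1"] by (simp add: powr_divide)

text \<open>An exact identity: the trapezoidal formula is inserted first for the inner harmonic sums
  and then for the three outer sums. Each remaining term carries a trapezoidal error or an explicit
  factor \<open>1 / n\<close>.\<close>

lemma scaled_gap_eq: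
  fixes a :: real and n r :: nat
  assumes r: "1 \<le> r" "r \<le> n"
  defines "x \<equiv> real r / real n"
  shows "real n powr (1 - a) * gap a n r - (real n * I a x + J a x)
    = trapezoid_error (\<lambda>y. y powr (a - 1) * ln y) n r n
      - (ln x + 1) * trapezoid_error (\<lambda>y. y powr (a - 1)) n r n
      + (trapezoid_error (\<lambda>y. y powr (a - 1)) n r n + (1 - x powr (a - 1)) / 2) / (2 * x * real n)
      - (trapezoid_error (\<lambda>y. y powr (a - 2)) n r n + (1 - x powr (a - 2)) / 2) / (2 * real n)
      + (\<Sum>k\<in>{r<..n}. (real k / real n) powr (a - 1) * (trapezoid_error (\<lambda>y. y powr - 1) n r k / real n))"
proof -
  have N: "real n > 0" and R: "real r > 0" using r by auto
  have x: "0 < x" "x \<le> 1" using r N by (auto simp: x_def)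
  have rx: "real r = x * real n" using N by (simp add: x_def)
  define y where "y = (\<lambda>k. real k / real n)"
  define S where "S = (\<Sum>k\<in>{r<..n}. y k powr (a - 1))"
  define Sl where "Sl = (\<Sum>k\<in>{r<..n}. y k powr (a - 1) * ln (y k))"
  define S2 where "S2 = (\<Sum>k\<in>{r<..n}. y k powr (a - 2))"
  define e where "e = (\<lambda>k. trapezoid_error (\<lambda>y. y powr - 1) n r k / real n)"
  define R where "R = (\<Sum>k\<in>{r<..n}. y k powr (a - 1) * e k)"
  define P where "P = integral {x..1} (\<lambda>y. y powr (a - 1))"
  define Q where "Q = integral {x..1} (\<lambda>y. y powr (a - 2))"
  define A where "A = integral {x..1} (\<lambda>y. y powr (a - 1) * ln y)"
  define T where "T = trapezoid_error (\<lambda>y. y powr (a - 1)) n r n"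
  define Tl where "Tl = trapezoid_error (\<lambda>y. y powr (a - 1) * ln y) n r n"
  define T2 where "T2 = trapezoid_error (\<lambda>y. y powr (a - 2)) n r n"
  have S: "S = T + real n * P + (1 - x powr (a - 1)) / 2"
    and Sl: "Sl = Tl + real n * A - x powr (a - 1) * ln x / 2"
    and S2: "S2 = T2 + real n * Q + (1 - x powr (a - 2)) / 2"
    using N by (simp_all add: S_def Sl_def S2_def y_def T_def Tl_def T2_def P_def A_def Q_def
        trapezoid_error_def x_def)
  \<comment> \<open>The terms with \<open>2 * real r\<close> and \<open>2 * real n\<close> are the
    two halves of \<open>(1 / r - 1 / k) / 2\<close>, using \<open>k = n * y k\<close>.\<close>
  have summand: "y k powr (a - 1) * harm_seg r k
      = y k powr (a - 1) * ln (y k) - ln x * y k powr (a - 1) + y k powr (a - 1) / (2 * real r)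
        - y k powr (a - 2) / (2 * real n)
        + y k powr (a - 1) * e k"
    if k: "k \<in> {r<..n}" for k
  proof -
    have "y k > 0" using k N by (simp add: y_def)
    then have "y k powr (a - 2) = y k powr (a - 1) / y k"
      by (simp add: powr_diff power2_eq_square flip: powr_realpow)
    then have 1: "y k powr (a - 2) / (2 * real n) = y k powr (a - 1) / (2 * real k)"
      using N by (simp add: y_def)
    have 2: "harm_seg r k = ln (y k) - ln x + (1 / real r - 1 / real k) / 2 + e k"
      using harm_seg_eq_trapezoid[of r k n] k r by (simp add: y_def x_def e_def)
    show ?thesis unfolding 1 2
      by (simp add: algebra_simps diff_divide_distrib)
  qed
  have "real n powr (1 - a) * harm_tail a n r = (\<Sum>k\<in>{r<..n}. y k powr (a - 1) * harm_seg r k)"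
    unfolding harm_tail_def sum_distrib_left y_def
    by (rule sum.cong[OF refl]) (use scaled_powr[of n a] N in \<open>simp flip: mult.assoc\<close>)
  also have "\<dots> = Sl - ln x * S + S / (2 * real r) - S2 / (2 * real n) + R"
    unfolding Sl_def S_def S2_def R_def
    by (simp add: summand sum.distrib sum_subtractf sum_distrib_left sum_divide_distrib)
  finally have 1: "real n powr (1 - a) * harm_tail a n r = Sl - ln x * S + S / (2 * real r) - S2 / (2 * real n) + R" .
  have "real n powr (1 - a) * tail a n (r - 1) = x powr (a - 1) + S"
    using scaled_powr[of n a] N tail_pred[OF r, of a]
    by (simp add: tail_def distrib_left sum_distrib_left S_def y_def x_def)
  with 1 have "real n powr (1 - a) * gap a n r
      = Sl - ln x * S + S / (2 * real r) - S2 / (2 * real n) + R - x powr (a - 1) - S"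
    by (simp add: gap_def right_diff_distrib)
  also have "S / (2 * real r) = P / (2 * x) + (T + (1 - x powr (a - 1)) / 2) / (2 * x * real n)"
    unfolding S rx using N x by (simp add: field_simps)
  also have "S2 / (2 * real n) = Q / 2 + (T2 + (1 - x powr (a - 2)) / 2) / (2 * real n)"
    unfolding S2 using N by (simp add: field_simps)
  finally have main: "real n powr (1 - a) * gap a n r
      = Sl - ln x * S + (P / (2 * x) + (T + (1 - x powr (a - 1)) / 2) / (2 * x * real n))
        - (Q / 2 + (T2 + (1 - x powr (a - 2)) / 2) / (2 * real n)) + R - x powr (a - 1) - S" .
  have I: "I a x = A - (ln x + 1) * P"
    using I_eq_log_moment[OF x] by (simp add: A_def P_def)
  have J: "J a x = (- ln x - 1 - x powr (a - 1)) / 2 + P / (2 * x) - Q / 2"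
    using x by (simp add: J_def P_def Q_def ln_div)
  \<comment> \<open>The end-point corrections of \<open>Sl\<close> and \<open>S\<close> combine with
    \<open>x powr (a - 1)\<close>, the term \<open>k = r\<close> of the tail; the products
    \<open>x powr (a - 1) * ln x\<close> cancel and the first summand of \<open>J\<close>
    remains.\<close>
  have "Sl - ln x * S - x powr (a - 1) - S
      = real n * I a x + (J a x - P / (2 * x) + Q / 2) + Tl - (ln x + 1) * T"
    unfolding Sl S I J by (simp add: field_simps)
  moreover have "s - l + (p + u) - (q + v) + w - xp - t - (m + j) = b - f + u - v + w"
    if "s - l - xp - t = m + (j - p + q) + b - f" for s l p u q v w xp t m j b f :: real
    using that by linarith
  ultimately show ?thesis
    unfolding main T_def[symmetric] Tl_def[symmetric] T2_def[symmetric] R_def[unfolded y_def e_def, symmetric]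
    by blast
qed

lemma scaled_gap_expansion:
  assumes d: "0 < d"
  shows "\<exists>K. \<forall>n r. 1 \<le> n \<and> d * real n \<le> real r \<and> r \<le> n \<longrightarrow>
    \<bar>real n powr (1 - a) * gap a n r - (real n * I a (real r / real n) + J a (real r / real n))\<bar> \<le> K / real n"
proof -
  obtain Bl where Bl: "0 \<le> Bl" "\<And>n r. 1 \<le> n \<Longrightarrow> d * real n \<le> real r \<Longrightarrow> r \<le> n \<Longrightarrow>
      \<bar>trapezoid_error (\<lambda>y. y powr (a - 1) * ln y) n r n\<bar> \<le> Bl / real n"
    using powr_ln_trapezoid_error_bound[OF d, of "a - 1"] by blast
  obtain B0 where B0: "0 \<le> B0" "\<And>n r. 1 \<le> n \<Longrightarrow> d * real n \<le> real r \<Longrightarrow> r \<le> n \<Longrightarrow>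
      \<bar>trapezoid_error (\<lambda>y. y powr (a - 1)) n r n\<bar> \<le> B0 / real n"
    using powr_trapezoid_error_bound[OF d, of "a - 1"] by blast
  obtain B2 where B2: "0 \<le> B2" "\<And>n r. 1 \<le> n \<Longrightarrow> d * real n \<le> real r \<Longrightarrow> r \<le> n \<Longrightarrow>
      \<bar>trapezoid_error (\<lambda>y. y powr (a - 2)) n r n\<bar> \<le> B2 / real n"
    using powr_trapezoid_error_bound[OF d, of "a - 2"] by blast
  obtain B1 where B1: "0 \<le> B1" "\<And>n r k. 1 \<le> n \<Longrightarrow> d * real n \<le> real r \<Longrightarrow> r \<le> k \<Longrightarrow> k \<le> n \<Longrightarrow>
      \<bar>trapezoid_error (\<lambda>y. y powr - 1) n r k\<bar> \<le> B1 / real n"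
    using powr_trapezoid_error_bound[OF d, of "- 1"] by blast
  define C1 where "C1 = 1 + d powr (a - 1)"
  define C2 where "C2 = 1 + d powr (a - 2)"
  \<comment> \<open>One summand for each term on the right of \<open>scaled_gap_eq\<close>, in the
    same order; \<open>1 - ln d\<close> bounds \<open>\<bar>ln x + 1\<bar>\<close>, and
    \<open>C1\<close>, \<open>C2\<close> bound the powers on \<open>[d, 1]\<close>.\<close>
  define K where "K = Bl + (1 - ln d) * B0 + (B0 + C1) / (2 * d) + (B2 + C2) / 2 + C1 * B1"
  show ?thesis
  proof (intro exI allI impI, elim conjE)
    fix n r :: nat
    assume n: "1 \<le> n" and dr: "d * real n \<le> real r" and rn: "r \<le> n"
    define x where "x = real r / real n"
    have N: "real n \<ge> 1" using n by simp
    have "0 < d * real n" using d N by simp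
    then have r: "1 \<le> r" using dr by (cases r) auto
    have x: "d \<le> x" "x \<le> 1" "0 < x" using dr N rn r by (auto simp: x_def field_simps)
    define T where "T = trapezoid_error (\<lambda>y. y powr (a - 1)) n r n"
    define Tl where "Tl = trapezoid_error (\<lambda>y. y powr (a - 1) * ln y) n r n"
    define T2 where "T2 = trapezoid_error (\<lambda>y. y powr (a - 2)) n r n"
    define R where "R = (\<Sum>k\<in>{r<..n}. (real k / real n) powr (a - 1) * (trapezoid_error (\<lambda>y. y powr - 1) n r k / real n))"
    have eq: "real n powr (1 - a) * gap a n r - (real n * I a x + J a x)
        = Tl - (ln x + 1) * T + (T + (1 - x powr (a - 1)) / 2) / (2 * x * real n)
          - (T2 + (1 - x powr (a - 2)) / 2) / (2 * real n) + R"
      using scaled_gap_eq[OF r rn, of a] by (simp add: x_def T_def Tl_def T2_def R_def)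
    have le1: "B / real n \<le> B" if "0 \<le> B" for B
      using that N by (simp add: divide_le_eq mult_left_le mult_le_cancel_left1)
    have 1: "\<bar>Tl\<bar> \<le> Bl / real n" unfolding Tl_def by (rule Bl(2)[OF n dr rn])
    have T: "\<bar>T\<bar> \<le> B0 / real n" unfolding T_def by (rule B0(2)[OF n dr rn])
    have T2: "\<bar>T2\<bar> \<le> B2 / real n" unfolding T2_def by (rule B2(2)[OF n dr rn])
    have xp: "\<bar>(1 - x powr (a - 1)) / 2\<bar> \<le> C1" "\<bar>(1 - x powr (a - 2)) / 2\<bar> \<le> C2"
    proof -
      have "\<bar>(1 - p) / 2\<bar> \<le> 1 + q" if "0 \<le> p" "p \<le> 1 + q" "0 \<le> q" for p q :: real
        using that by (simp add: abs_le_iff field_simps)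
      then show "\<bar>(1 - x powr (a - 1)) / 2\<bar> \<le> C1" "\<bar>(1 - x powr (a - 2)) / 2\<bar> \<le> C2"
        using powr_le_unit_interval[OF d x(1,2)] by (simp_all add: C1_def C2_def)
    qed
    have "\<bar>ln x + 1\<bar> \<le> 1 - ln d"
    proof -
      have "ln d \<le> ln x" "ln x \<le> 0" using x d by simp_all
      then show ?thesis by linarith
    qed
    then have 2: "\<bar>(ln x + 1) * T\<bar> \<le> (1 - ln d) * (B0 / real n)"
      unfolding abs_mult using T by (intro mult_mono) auto
    have add_bound: "\<bar>t + p\<bar> \<le> B + C" if "\<bar>t\<bar> \<le> q" "\<bar>p\<bar> \<le> C" "q \<le> B" for t p q B C :: real
      using that abs_triangle_ineq[of t p] by linarith
    have "\<bar>T + (1 - x powr (a - 1)) / 2\<bar> \<le> B0 + C1"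
      using T xp(1) le1[OF B0(1)] by (rule add_bound)
    then have 3: "\<bar>(T + (1 - x powr (a - 1)) / 2) / (2 * x * real n)\<bar> \<le> (B0 + C1) / (2 * d * real n)"
      unfolding abs_divide using x d N by (intro frac_le) auto
    have "\<bar>T2 + (1 - x powr (a - 2)) / 2\<bar> \<le> B2 + C2"
      using T2 xp(2) le1[OF B2(1)] by (rule add_bound)
    then have 4: "\<bar>(T2 + (1 - x powr (a - 2)) / 2) / (2 * real n)\<bar> \<le> (B2 + C2) / (2 * real n)"
      unfolding abs_divide using N by (intro frac_le) auto
    \<comment> \<open>At most \<open>n\<close> terms, each of order \<open>1 / n^2\<close>.\<close>
    have "\<bar>R\<bar> \<le> (\<Sum>k\<in>{r<..n}. C1 * (B1 / real n / real n))"
      unfolding R_def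
    proof (rule order_trans[OF sum_abs sum_mono])
      fix k assume k: "k \<in> {r<..n}"
      have "d \<le> real k / real n" "real k / real n \<le> 1"
        using dr k N by (auto simp: field_simps)
      from powr_le_unit_interval[OF d this] have "(real k / real n) powr (a - 1) \<le> C1"
        by (simp add: C1_def)
      moreover have "\<bar>trapezoid_error (\<lambda>y. y powr - 1) n r k / real n\<bar> \<le> B1 / real n / real n"
        using B1(2)[OF n dr, of k] k N unfolding abs_divide by (intro divide_mono) auto
      ultimately show "\<bar>(real k / real n) powr (a - 1) * (trapezoid_error (\<lambda>y. y powr - 1) n r k / real n)\<bar>
          \<le> C1 * (B1 / real n / real n)"
        unfolding abs_mult by (intro mult_mono) (auto simp: C1_def)
    qed
    also have "\<dots> \<le> real n * (C1 * (B1 / real n / real n))"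
    proof -
      have "0 \<le> C1 * (B1 / real n / real n)" using B1(1) by (simp add: C1_def)
      then have "real (n - r) * (C1 * (B1 / real n / real n)) \<le> real n * (C1 * (B1 / real n / real n))"
        by (intro mult_right_mono) auto
      then show ?thesis by simp
    qed
    also have "\<dots> = C1 * B1 / real n" using N by simp
    finally have 5: "\<bar>R\<bar> \<le> C1 * B1 / real n" .
    have "\<bar>real n powr (1 - a) * gap a n r - (real n * I a x + J a x)\<bar>
      \<le> Bl / real n + (1 - ln d) * (B0 / real n) + (B0 + C1) / (2 * d * real n)
        + (B2 + C2) / (2 * real n) + C1 * B1 / real n"
    proof -
      have "\<bar>t1 - t2 + t3 - t4 + t5\<bar> \<le> b1 + b2 + b3 + b4 + b5"
        if "\<bar>t1\<bar> \<le> b1" "\<bar>t2\<bar> \<le> b2" "\<bar>t3\<bar> \<le> b3" "\<bar>t4\<bar> \<le> b4" "\<bar>t5\<bar> \<le> b5"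
        for t1 t2 t3 t4 t5 b1 b2 b3 b4 b5 :: real
        using that by linarith
      from this[OF 1 2 3 4 5] show ?thesis unfolding eq .
    qed
    also have "\<dots> = K / real n"
      by (simp add: K_def add_divide_distrib)
    finally show "\<bar>real n powr (1 - a) * gap a n r - (real n * I a (real r / real n) + J a (real r / real n))\<bar> \<le> K / real n"
      by (simp add: x_def)
  qed
qed

section \<open>Taylor expansion at the zero\<close>

lemma DERIV_local_Lipschitz:
  fixes f :: "real \<Rightarrow> real"
  assumes "(f has_real_derivative m) (at z)"
  obtains C d where "0 < C" "0 < d" "\<And>x. \<bar>x - z\<bar> < d \<Longrightarrow> \<bar>f x - f z\<bar> \<le> C * \<bar>x - z\<bar>"
proof -
  have "((\<lambda>x. (f x - f z) / (x - z)) \<longlongrightarrow> m) (at z)"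
    using assms by (simp add: has_field_derivative_iff)
  then have "\<forall>\<^sub>F x in at z. dist ((f x - f z) / (x - z)) m < 1"
    by (rule tendstoD) simp
  then obtain d where d: "0 < d" "\<And>x. x \<noteq> z \<Longrightarrow> dist x z < d \<Longrightarrow> dist ((f x - f z) / (x - z)) m < 1"
    unfolding eventually_at by auto
  have "\<bar>f x - f z\<bar> \<le> (\<bar>m\<bar> + 1) * \<bar>x - z\<bar>" if "\<bar>x - z\<bar> < d" for x
  proof (cases "x = z")
    case False
    then have "\<bar>(f x - f z) / (x - z) - m\<bar> < 1"
      using d(2)[of x] that by (simp add: dist_real_def)
    then have "\<bar>(f x - f z) / (x - z)\<bar> \<le> \<bar>m\<bar> + 1" by linarith
    then show ?thesis using False by (simp add: abs_divide divide_le_eq)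
  qed simp
  then show thesis using that[of "\<bar>m\<bar> + 1" d] d(1) by auto
qed

text \<open>By the mean value theorem the remainder is \<open>(x - z) * (f' y - f' z)\<close> with
  \<open>y\<close> between \<open>x\<close> and \<open>z\<close>, and \<open>f'\<close> is locally
  Lipschitz at \<open>z\<close>.\<close>

lemma DERIV_local_quadratic:
  fixes f f' :: "real \<Rightarrow> real"
  assumes f: "\<And>x. \<bar>x - z\<bar> < e \<Longrightarrow> (f has_real_derivative f' x) (at x)" and e: "0 < e"
    and f': "(f' has_real_derivative m) (at z)"
  shows "\<exists>C d. 0 < C \<and> 0 < d \<and> (\<forall>x. \<bar>x - z\<bar> < d \<longrightarrow> \<bar>f x - f z - f' z * (x - z)\<bar> \<le> C * (x - z)\<^sup>2)"
proof -
  obtain C d where C: "0 < C" "0 < d" "\<And>x. \<bar>x - z\<bar> < d \<Longrightarrow> \<bar>f' x - f' z\<bar> \<le> C * \<bar>x - z\<bar>"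
    using DERIV_local_Lipschitz[OF f'] by blast
  have "\<bar>f x - f z - f' z * (x - z)\<bar> \<le> C * (x - z)\<^sup>2" if x: "\<bar>x - z\<bar> < min d e" for x
  proof (cases "x = z")
    case False
    have "\<exists>y. \<bar>y - z\<bar> \<le> \<bar>x - z\<bar> \<and> f x - f z = (x - z) * f' y"
    proof (cases "x < z")
      case True
      have "\<exists>y. x < y \<and> y < z \<and> f z - f x = (z - x) * f' y"
        using True x by (intro MVT2 f) auto
      then obtain y where "x < y" "y < z" "f z - f x = (z - x) * f' y" by blast
      then show ?thesis using True by (intro exI[of _ y]) (auto simp: algebra_simps)
    next
      case ge: False
      have "\<exists>y. z < y \<and> y < x \<and> f x - f z = (x - z) * f' y"
        using ge x False by (intro MVT2 f) auto
      then obtain y where "z < y" "y < x" "f x - f z = (x - z) * f' y" by blast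
      then show ?thesis by (intro exI[of _ y]) auto
    qed
    then obtain y where y: "\<bar>y - z\<bar> \<le> \<bar>x - z\<bar>" "f x - f z = (x - z) * f' y" by blast
    have "\<bar>f x - f z - f' z * (x - z)\<bar> = \<bar>x - z\<bar> * \<bar>f' y - f' z\<bar>"
      unfolding y(2) abs_mult[symmetric] by (simp add: algebra_simps)
    also have "\<dots> \<le> \<bar>x - z\<bar> * (C * \<bar>x - z\<bar>)"
    proof (intro mult_left_mono order_trans[OF C(3)[of y]])
      show "\<bar>y - z\<bar> < d" using y(1) x by simp
    qed (use y(1) C(1) in auto)
    also have "\<dots> = C * (x - z)\<^sup>2" by (simp add: power2_eq_square mult.left_commute)
    finally show ?thesis .
  qed simp
  then show ?thesis using C e by (intro exI[of _ C] exI[of _ "min d e"]) auto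
qed

lemma J_differentiable:
  assumes "0 < x" "x < 1"
  obtains D' where "(J a has_real_derivative D') (at x)"
proof -
  have int: "((\<lambda>x. integral {x..1} (\<lambda>y. y powr b)) has_real_derivative - (x powr b)) (at x)" for b
    using assms by (intro integral_lower_deriv continuous_intros) auto
  have "\<exists>D'. ((\<lambda>x. 1 / 2 * (ln (1 / x) - 1 - x powr (a - 1))
     + 1 / (2 * x) * integral {x..1} (\<lambda>y. y powr (a - 1))
     - 1 / 2 * integral {x..1} (\<lambda>y. y powr (a - 2))) has_real_derivative D') (at x)"
    by (rule exI) (use assms in \<open>auto intro!: derivative_eq_intros int\<close>)
  then show thesis using that unfolding J_def[abs_def] by blast
qed

lemma I_second_derivative:
  assumes "0 < x"
  obtains D' where "((\<lambda>x. (x powr a - pow_int a x) / x) has_real_derivative D') (at x)"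
proof -
  have "\<exists>D'. ((\<lambda>x. (x powr a - pow_int a x) / x) has_real_derivative D') (at x)"
    by (rule exI) (use assms in \<open>auto intro!: derivative_eq_intros pow_int_deriv\<close>)
  then show thesis using that by blast
qed

lemma D_eq_scaled_gap:
  assumes "1 \<le> r" "r \<le> n"
  shows "D a n r = real n powr (1 - a) * gap a n r"
  using Delta_eq_gap[OF assms, of a] by (simp add: D_def mult_ac)

text \<open>With \<open>x = r / n\<close> one has \<open>x - l = u / n\<close>, so
  \<open>n I(x)\<close> equals \<open>I'(l) u\<close> up to \<open>O(1 / n)\<close> and
  \<open>J(x)\<close> equals \<open>J(l) = - I'(l) c\<close> up to \<open>O(1 / n)\<close>.\<close>

lemma D_expansion:
  assumes a: "a \<ge> 0" and M: "M > 0"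
  shows "\<exists>K n0. \<forall>n\<ge>n0. \<forall>u::real. \<forall>r\<in>{1..n}. \<bar>u\<bar> \<le> M \<and> real r = ell a * real n + u \<longrightarrow>
    \<bar>D a n r - deriv (I a) (ell a) * (u - c a)\<bar> \<le> K / real n"
proof -
  define l where "l = ell a"
  note ell = ell_props[OF a, folded l_def]
  obtain K where K: "\<And>n r. 1 \<le> n \<Longrightarrow> l / 2 * real n \<le> real r \<Longrightarrow> r \<le> n \<Longrightarrow>
    \<bar>real n powr (1 - a) * gap a n r - (real n * I a (real r / real n) + J a (real r / real n))\<bar> \<le> K / real n"
    using scaled_gap_expansion[of "l / 2" a] half_gt_zero[OF ell(1)] by blast
  have I': "deriv (I a) l = (l powr a - pow_int a l) / l"
    using ell by (intro DERIV_imp_deriv I_deriv)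
  obtain m where "((\<lambda>x. (x powr a - pow_int a x) / x) has_real_derivative m) (at l)"
    using I_second_derivative[OF ell(1)] .
  then have "\<exists>C d. 0 < C \<and> 0 < d \<and> (\<forall>x. \<bar>x - l\<bar> < d \<longrightarrow>
      \<bar>I a x - I a l - (l powr a - pow_int a l) / l * (x - l)\<bar> \<le> C * (x - l)\<^sup>2)"
  proof (rule DERIV_local_quadratic[rotated 2])
    show "(I a has_real_derivative (x powr a - pow_int a x) / x) (at x)" if "\<bar>x - l\<bar> < min l (1 - l)" for x
      using that by (intro I_deriv) (auto simp: abs_less_iff)
    show "0 < min l (1 - l)" using ell by simp
  qed
  then obtain C d where C: "0 < C" "0 < d"
      "\<And>x. \<bar>x - l\<bar> < d \<Longrightarrow> \<bar>I a x - deriv (I a) l * (x - l)\<bar> \<le> C * (x - l)\<^sup>2"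
    unfolding I'[symmetric] ell(4) by auto
  obtain D1 where "(J a has_real_derivative D1) (at l)"
    using J_differentiable[OF ell(1,2)] .
  then obtain C' d' where C': "0 < C'" "0 < d'"
      "\<And>x. \<bar>x - l\<bar> < d' \<Longrightarrow> \<bar>J a x - J a l\<bar> \<le> C' * \<bar>x - l\<bar>"
    using DERIV_local_Lipschitz by blast
  \<comment> \<open>Radius on which both local expansions hold and \<open>x \<ge> l / 2\<close>, as
    \<open>K\<close> demands; \<open>n0\<close> ensures that \<open>M / n < e\<close>.\<close>
  define e where "e = min (l / 2) (min d d')"
  have e: "0 < e" using ell C C' by (simp add: e_def)
  define n0 where "n0 = nat \<lceil>M / e\<rceil> + 1"
  show ?thesis
  proof (rule exI[of _ "K + C * M\<^sup>2 + C' * M"], rule exI[of _ n0], intro allI ballI impI, elim conjE)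
    fix n r :: nat and u :: real
    assume n: "n \<ge> n0" and r: "r \<in> {1..n}" and u: "\<bar>u\<bar> \<le> M" and ru: "real r = ell a * real n + u"
    have N: "real n > 0" using n by (simp add: n0_def)
    have "M / e < real n" using n unfolding n0_def by linarith
    then have "M < e * real n" using e by (simp add: field_simps)
    define x where "x = real r / real n"
    have xl: "x - l = u / real n" using N ru by (simp add: x_def l_def field_simps)
    have "\<bar>x - l\<bar> < e" using u \<open>M < e * real n\<close> N by (simp add: xl abs_divide divide_less_eq)
    then have near: "\<bar>x - l\<bar> < d" "\<bar>x - l\<bar> < d'" "l / 2 \<le> x"
      unfolding e_def by (auto simp: abs_if split: if_splits)
    have "l / 2 * real n \<le> real r" using near(3) N by (simp add: x_def field_simps)
    then have 1: "\<bar>D a n r - (real n * I a x + J a x)\<bar> \<le> K / real n"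
      using K[of n r] r N by (simp add: D_eq_scaled_gap x_def)
    have "\<bar>real n * I a x - deriv (I a) l * u\<bar> = real n * \<bar>I a x - deriv (I a) l * (x - l)\<bar>"
      using N by (simp add: xl right_diff_distrib abs_mult[of "real n", symmetric, simplified])
    also have "\<dots> \<le> real n * (C * (x - l)\<^sup>2)"
      using C(3)[OF near(1)] N by (intro mult_left_mono) auto
    also have "\<dots> = C * u\<^sup>2 / real n"
      using N by (simp add: xl power_divide power2_eq_square)
    also have "\<dots> \<le> C * M\<^sup>2 / real n"
      using u C(1) N M by (intro divide_right_mono mult_left_mono) (auto simp: abs_le_square_iff[symmetric])
    finally have 2: "\<bar>real n * I a x - deriv (I a) l * u\<bar> \<le> C * M\<^sup>2 / real n" .
    have "\<bar>J a x - J a l\<bar> \<le> C' * (\<bar>u\<bar> / real n)"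
      using C'(3)[OF near(2)] by (simp add: xl)
    also have "\<dots> \<le> C' * (M / real n)"
      using u C'(1) N by (intro mult_left_mono divide_right_mono) auto
    finally have 3: "\<bar>J a x - J a l\<bar> \<le> C' * M / real n" by simp
    have "deriv (I a) l * c a = - J a l"
      using deriv_I_ell_neg[OF a] by (simp add: c_def l_def)
    then have "D a n r - deriv (I a) l * (u - c a)
      = (D a n r - (real n * I a x + J a x)) + (real n * I a x - deriv (I a) l * u) + (J a x - J a l)"
      by (simp add: algebra_simps)
    then have "\<bar>D a n r - deriv (I a) l * (u - c a)\<bar> \<le> K / real n + C * M\<^sup>2 / real n + C' * M / real n"
      using 1 2 3 by linarith
    then show "\<bar>D a n r - deriv (I a) (ell a) * (u - c a)\<bar> \<le> (K + C * M\<^sup>2 + C' * M) / real n"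
      by (simp add: l_def add_divide_distrib)
  qed
qed

section \<open>Location of the maximizer\<close>

lemma D_sign: "1 \<le> r \<Longrightarrow> r \<le> n \<Longrightarrow> 0 \<le> D a n r \<longleftrightarrow> 0 \<le> gap a n r"
  by (simp add: D_eq_scaled_gap zero_le_mult_iff)

lemma r_opt_near_ell:
  assumes a: "a \<ge> 0"
  shows "\<forall>\<^sub>F n in sequentially. \<bar>real (r_opt a n) - ell a * real n\<bar> \<le> 3"
proof -
  define l where "l = ell a"
  define s where "s = - deriv (I a) l"
  have l: "0 < l" "l < 1" using ell_props[OF a] by (simp_all add: l_def)
  have s: "s > 0" using deriv_I_ell_neg[OF a] by (simp add: s_def l_def)
  note c = c_bounds[OF a]
  obtain K n0 where K0: "\<And>n u r. n \<ge> n0 \<Longrightarrow> r \<in> {1..n} \<Longrightarrow> \<bar>u\<bar> \<le> 3 \<Longrightarrow> real r = l * real n + u \<Longrightarrow>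
      \<bar>D a n r - deriv (I a) l * (u - c a)\<bar> \<le> K / real n"
    using D_expansion[OF a, of 3] unfolding l_def
    by (meson zero_less_numeral)
  have K: "\<bar>D a n r + s * (u - c a)\<bar> \<le> K / real n"
    if "n \<ge> n0" "r \<in> {1..n}" "\<bar>u\<bar> \<le> 3" "real r = l * real n + u" for n u r
    using K0[OF that] by (simp add: s_def)
  have "\<forall>\<^sub>F n in sequentially. K / real n < s"
    using s by (intro order_tendstoD[OF lim_const_over_n])
  \<comment> \<open>These two conditions place \<open>l * n - 3\<close> and \<open>l * n + 3\<close>
    strictly between 0 and \<open>n\<close>, so that the test indices below lie in
    \<open>{1..n}\<close>.\<close>
  moreover have "\<forall>\<^sub>F n in sequentially. 3 / real n < l"
    using l by (intro order_tendstoD[OF lim_const_over_n])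
  moreover have "\<forall>\<^sub>F n in sequentially. 3 / real n < 1 - l"
    using l by (intro order_tendstoD[OF lim_const_over_n]) simp
  ultimately show ?thesis
    using eventually_ge_at_top[of n0] eventually_gt_at_top[of 0]
  proof eventually_elim
    case (elim n)
    then have N: "real n > 0" by simp
    have ln: "3 < l * real n" "l * real n + 3 < real n"
      using elim N by (simp_all add: field_simps)
    \<comment> \<open>\<open>p\<close> is the least integer with \<open>u - c a \<ge> 1\<close> and
      \<open>q\<close> the greatest with \<open>u - c a \<le> - 1\<close>. The main term then has
      size at least \<open>s\<close>, exceeding the error \<open>K / n\<close>, and
      \<open>0 < c a < 1 / 2\<close> keeps both offsets within 3.\<close>
    define p where "p = nat \<lceil>l * real n + c a + 1\<rceil>"
    define q where "q = nat \<lfloor>l * real n + c a - 1\<rfloor>"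
    have p: "l * real n + c a + 1 \<le> real p" "real p < l * real n + c a + 2"
      unfolding p_def using ln c by linarith+
    have q: "real q \<le> l * real n + c a - 1" "l * real n + c a - 2 < real q"
      unfolding q_def using ln c by linarith+
    have pr: "p \<in> {1..n}" and qr: "q \<in> {1..n}"
      using p q ln c by auto
    have "\<bar>D a n p + s * (real p - l * real n - c a)\<bar> \<le> K / real n"
      using elim p c pr by (intro K) auto
    moreover have "s * 1 \<le> s * (real p - l * real n - c a)"
      using s p by (intro mult_left_mono) auto
    ultimately have "D a n p < 0" using elim by linarith
    then have "r_opt a n < p"
      using unimodal_V_r_opt(3)[OF a, of p n] D_sign[of p n a] pr by (auto simp: not_le[symmetric])
    have "\<bar>D a n q + s * (real q - l * real n - c a)\<bar> \<le> K / real n"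
      using elim q c qr by (intro K) auto
    moreover have "s * (real q - l * real n - c a) \<le> s * (- 1)"
      using s q by (intro mult_left_mono) auto
    ultimately have "0 \<le> D a n q" using elim by linarith
    then have "q \<le> r_opt a n"
      using unimodal_V_r_opt(3)[OF a, of q n] D_sign[of q n a] qr by auto
    then show ?case
      using \<open>r_opt a n < p\<close> p q c unfolding l_def by linarith
  qed
qed

lemma r_opt_limit:
  assumes a: "a \<ge> 0"
  shows "(\<lambda>n. real (r_opt a n) / real n) \<longlonglongrightarrow> ell a"
proof -
  have "(\<lambda>n. real (r_opt a n) / real n - ell a) \<longlonglongrightarrow> 0"
  proof (rule Lim_null_comparison[OF _ lim_const_over_n[of 3]])
    show "\<forall>\<^sub>F n in sequentially. norm (real (r_opt a n) / real n - ell a) \<le> 3 / real n"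
      using r_opt_near_ell[OF a] eventually_gt_at_top[of 0]
    proof eventually_elim
      case (elim n)
      then have "real (r_opt a n) / real n - ell a = (real (r_opt a n) - ell a * real n) / real n"
        by (simp add: field_simps)
      then show ?case using elim by (simp add: abs_divide divide_right_mono)
    qed
  qed
  then show ?thesis by (simp add: LIM_zero_iff)
qed

theorem mainTheorem7:
  fixes a :: real
  assumes "a \<ge> 0"
  shows "((\<exists>!x. x \<in> {0<..<1} \<and> I a x = 0) \<and>
          I a field_differentiable at (ell a) \<and> deriv (I a) (ell a) < 0) \<and>
         ((\<forall>n\<ge>1. unimodal n (V a n)) \<and>
          (\<lambda>n. real (r_opt a n) / real n) \<longlonglongrightarrow> ell a) \<and>
         (0 < c a \<and> c a < 1 / 2 \<and>
          (\<forall>M>0. \<exists>K n0. \<forall>n\<ge>n0. \<forall>u::real. \<forall>r\<in>{1..n}.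
             \<bar>u\<bar> \<le> M \<and> real r = ell a * real n + u \<longrightarrow>
             \<bar>D a n r - deriv (I a) (ell a) * (u - c a)\<bar> \<le> K / real n))"
proof (intro conjI)
  show "\<exists>!x. x \<in> {0<..<1} \<and> I a x = 0" using assms by (rule ex1_I_zero)
  show "I a field_differentiable at (ell a)"
    using I_deriv[of "ell a" a] ell_props[OF assms] unfolding field_differentiable_def by blast
  show "deriv (I a) (ell a) < 0" using assms by (rule deriv_I_ell_neg)
  show "\<forall>n\<ge>1. unimodal n (V a n)" using unimodal_V_r_opt(1)[OF assms] by blast
  show "(\<lambda>n. real (r_opt a n) / real n) \<longlonglongrightarrow> ell a" using assms by (rule r_opt_limit)
  show "0 < c a" "c a < 1 / 2" using c_bounds[OF assms] by blast+
  show "\<forall>M>0. \<exists>K n0. \<forall>n\<ge>n0. \<forall>u::real. \<forall>r\<in>{1..n}.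
             \<bar>u\<bar> \<le> M \<and> real r = ell a * real n + u \<longrightarrow>
             \<bar>D a n r - deriv (I a) (ell a) * (u - c a)\<bar> \<le> K / real n"
    using D_expansion[OF assms] by blast
qed

end
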